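(* Let $k\in\mathbb{N}$ (so $k\ge 1$) and let $0<\alpha<1$ be a real number. Let $E$ be a nonempty open interval in $\mathbb{R}$. For $f\in C^k(E,\mathbb{R})$ put $$ I_\alpha(f) := \{\, y\in\mathbb{R} : \dim f^{-1}(y) \ge \alpha \,\}, \qquad L(\alpha,f) := \dim I_\alpha(f). $$ Then $$ \sup\left\{ L(\alpha,f) : f\in C^k(E,\mathbb{R}) \right\} = \frac{1-\alpha}{k}. $$
   Context: $C^k(E,\mathbb{R})$ denotes the set of all $k$-times continuously differentiable functions $f:E\to\mathbb{R}$. For $S\subset\mathbb{R}$, $\dim S$ denotes the Hausdorff dimension of $S$ (with the usual convention that the empty set has dimension $0$). For $y\in\mathbb{R}$, $f^{-1}(y)=\{x\in E: f(x)=y\}$ is the level set (preimage) of $y$. *)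

theory Defs
  imports "HOL-Analysis.Analysis"
begin

section \<open>Hausdorff measure and Hausdorff dimension\<close>

text \<open>
  The weight of a covering set is its diameter to the power \<open>s\<close>.  The cases \<open>U = {}\<close> and \<open>s = 0\<close>
  are separate because \<open>0 powr 0 = 0\<close>, whereas a nonempty set must have weight 1 for \<open>s = 0\<close>
  (so that the 0-dimensional measure is counting measure).
\<close>

definition diam_pow :: "real \<Rightarrow> 'a::metric_space set \<Rightarrow> ennreal" where
  "diam_pow s U = (if U = {} then 0 else if s = 0 then 1 else ennreal (diameter U powr s))"

text \<open>
  Boundedness of the covering sets is required explicitly, since \<open>diameter\<close> is real-valued and
  hence unspecified on unbounded sets.  Finite covers are included by padding with \<open>{}\<close>.
\<close>

definition delta_covers :: "real \<Rightarrow> 'a::metric_space set \<Rightarrow> (nat \<Rightarrow> 'a set) set" where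
  "delta_covers \<delta> S = {U. S \<subseteq> (\<Union>i. U i) \<and> (\<forall>i. bounded (U i) \<and> diameter (U i) \<le> \<delta>)}"

definition hausdorff_premeasure :: "real \<Rightarrow> real \<Rightarrow> 'a::metric_space set \<Rightarrow> ennreal" where
  "hausdorff_premeasure s \<delta> S = (INF U\<in>delta_covers \<delta> S. \<Sum>i. diam_pow s (U i))"

definition hausdorff_measure :: "real \<Rightarrow> 'a::metric_space set \<Rightarrow> ennreal" where
  "hausdorff_measure s S = (SUP \<delta>\<in>{0<..}. hausdorff_premeasure s \<delta> S)"

definition hausdorff_dim :: "'a::metric_space set \<Rightarrow> ereal" where
  "hausdorff_dim S = Inf (ereal ` {s. 0 \<le> s \<and> hausdorff_measure s S = 0})"

lemma hausdorff_dim_empty: "hausdorff_dim ({} :: 'a::metric_space set) = 0"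
proof -
  have pre: "hausdorff_premeasure s \<delta> ({} :: 'a set) = 0" if "\<delta> > 0" for s \<delta>
  proof -
    have "(\<lambda>_. {}) \<in> delta_covers \<delta> ({} :: 'a set)"
      using that by (simp add: delta_covers_def)
    then have "hausdorff_premeasure s \<delta> ({} :: 'a set) \<le> (\<Sum>i::nat. diam_pow s ({} :: 'a set))"
      unfolding hausdorff_premeasure_def by (rule INF_lower)
    then show ?thesis by (simp add: diam_pow_def)
  qed
  have "hausdorff_measure s ({} :: 'a set) = 0" for s
    unfolding hausdorff_measure_def by (auto simp: pre intro!: antisym SUP_least)
  then have "ereal 0 \<in> ereal ` {s. 0 \<le> s \<and> hausdorff_measure s ({} :: 'a set) = 0}"
    by auto
  then have "hausdorff_dim ({} :: 'a set) \<le> 0"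
    unfolding hausdorff_dim_def zero_ereal_def by (rule Inf_lower)
  moreover have "0 \<le> hausdorff_dim ({} :: 'a set)"
    unfolding hausdorff_dim_def by (rule Inf_greatest) auto
  ultimately show ?thesis by (rule antisym)
qed


section \<open>Functions of class \<open>C\<^sup>k\<close> and their large level sets\<close>

text \<open>
  Functions \<open>E \<rightarrow> \<real>\<close> are modelled by total functions whose values outside \<open>E\<close> are irrelevant.
  This is meant for open \<open>E\<close>, where iterated derivatives at points of \<open>E\<close> depend only on the
  restriction to \<open>E\<close>.  Continuity of the derivatives of order less than \<open>k\<close> follows from their
  differentiability.
\<close>

definition C_k :: "nat \<Rightarrow> real set \<Rightarrow> (real \<Rightarrow> real) set" where
  "C_k k E = {f. (\<forall>j<k. \<forall>x\<in>E. (deriv ^^ j) f field_differentiable at x) \<and>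
                 continuous_on E ((deriv ^^ k) f)}"

definition level_set :: "real set \<Rightarrow> (real \<Rightarrow> real) \<Rightarrow> real \<Rightarrow> real set" where
  "level_set E f y = {x \<in> E. f x = y}"

definition I_set :: "real set \<Rightarrow> real \<Rightarrow> (real \<Rightarrow> real) \<Rightarrow> real set" where
  "I_set E \<alpha> f = {y. hausdorff_dim (level_set E f y) \<ge> ereal \<alpha>}"

definition L_dim :: "real set \<Rightarrow> real \<Rightarrow> (real \<Rightarrow> real) \<Rightarrow> ereal" where
  "L_dim E \<alpha> f = hausdorff_dim (I_set E \<alpha> f)"

end

theory Submission imports Defs begin

text \<open>
  Upper bound: apart from countably many points, a level set consists of accumulation points, where
  Rolle's theorem makes the derivatives of order \<open>1, \<dots>, k - 1\<close> vanish. By Taylor's formula \<open>f\<close>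
  maps a piece of length \<open>h\<close> around such points into an interval of length \<open>C * h ^ k\<close>. Values whose
  fibre has dimension above \<open>\<beta>\<close> are hit by at least about \<open>h powr - \<beta>\<close> of the \<open>1 / h\<close> pieces, so
  about \<open>h powr (\<beta> - 1)\<close> intervals of length \<open>C * h ^ k\<close> suffice to cover these values.

  Lower bound: take \<open>F x = (\<Sum>n. \<rho> ^ n * h (R ^ n * x))\<close> with \<open>\<rho> * R ^ k < 1\<close> and a \<open>p\<close>-periodic
  \<open>h\<close> of class \<open>C\<^sup>k\<close> that is constantly \<open>z mod p\<close> on \<open>[z, z + 1 / 2]\<close>. If the base \<open>R\<close> digits of \<open>x\<close>
  are \<open>i\<^sub>n + p * j\<^sub>n\<close> with \<open>i\<^sub>n < p\<close>, \<open>j\<^sub>n < m\<close> and \<open>R = 4 * m * p\<close>, then \<open>F x = (\<Sum>n. \<rho> ^ n * i\<^sub>n)\<close>: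
  the digits \<open>j\<^sub>n\<close> sweep out fibres of dimension \<open>ln m / ln R\<close> and the digits \<open>i\<^sub>n\<close> a set of values of
  dimension \<open>ln p / ln (1 / \<rho>)\<close>.
\<close>

section \<open>Hausdorff measure and dimension\<close>

lemma hausdorff_premeasure_le_finite_cover:
  fixes S :: "'a::metric_space set"
  assumes fin: "finite I" and cov: "S \<subseteq> (\<Union>i\<in>I. V i)"
    and V: "\<And>i. i \<in> I \<Longrightarrow> bounded (V i) \<and> diameter (V i) \<le> \<delta>" and "\<delta> \<ge> 0"
  shows "hausdorff_premeasure s \<delta> S \<le> (\<Sum>i\<in>I. diam_pow s (V i))"
proof -
  obtain h where h: "bij_betw h {0..<card I} I"
    using ex_bij_betw_nat_finite[OF fin] by blast
  \<comment> \<open>Padding with \<open>{}\<close> costs nothing, since its weight is 0 even for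
    \<open>s = 0\<close>, and it is admissible because \<open>\<delta> \<ge> 0\<close>.\<close>
  define U where "U j = (if j < card I then V (h j) else {})" for j
  have hI: "h j \<in> I" if "j < card I" for j
    using h that by (auto simp: bij_betw_def)
  have "U \<in> delta_covers \<delta> S"
  proof -
    have "x \<in> (\<Union>j. U j)" if x: "x \<in> S" for x
    proof -
      obtain i where i: "i \<in> I" "x \<in> V i" using x cov by blast
      from i(1) have "i \<in> h ` {0..<card I}" using h by (simp add: bij_betw_def)
      then obtain j where "j < card I" "h j = i" by auto
      then have "x \<in> U j" using i by (simp add: U_def)
      then show ?thesis by blast
    qed
    moreover have "bounded (U j) \<and> diameter (U j) \<le> \<delta>" for j
      using V hI \<open>\<delta> \<ge> 0\<close> by (auto simp: U_def)
    ultimately show ?thesis unfolding delta_covers_def by blast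
  qed
  then have "hausdorff_premeasure s \<delta> S \<le> (\<Sum>j. diam_pow s (U j))"
    unfolding hausdorff_premeasure_def by (rule INF_lower)
  also have "\<dots> = (\<Sum>j\<in>{0..<card I}. diam_pow s (U j))"
    by (rule suminf_finite) (auto simp: U_def diam_pow_def)
  also have "\<dots> = (\<Sum>j\<in>{0..<card I}. diam_pow s (V (h j)))"
    by (rule sum.cong) (auto simp: U_def)
  also have "\<dots> = (\<Sum>i\<in>I. diam_pow s (V i))"
    using sum.reindex_bij_betw[OF h] .
  finally show ?thesis .
qed

lemma hausdorff_premeasure_antimono:
  assumes "\<delta> \<le> \<delta>'"
  shows "hausdorff_premeasure s \<delta>' S \<le> hausdorff_premeasure s \<delta> S"
  unfolding hausdorff_premeasure_def
  by (rule INF_superset_mono) (use assms in \<open>auto simp: delta_covers_def intro: order_trans\<close>)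

lemma hausdorff_premeasure_mono:
  assumes "S \<subseteq> T"
  shows "hausdorff_premeasure s \<delta> S \<le> hausdorff_premeasure s \<delta> T"
  unfolding hausdorff_premeasure_def
  by (rule INF_superset_mono) (use assms in \<open>auto simp: delta_covers_def\<close>)

lemma hausdorff_measure_eq_0_iff:
  "hausdorff_measure s S = 0 \<longleftrightarrow> (\<forall>\<delta>>0. hausdorff_premeasure s \<delta> S = 0)"
proof -
  have "hausdorff_measure s S = 0 \<longleftrightarrow> hausdorff_measure s S \<le> 0" by simp
  also have "\<dots> \<longleftrightarrow> (\<forall>\<delta>>0. hausdorff_premeasure s \<delta> S = 0)"
    unfolding hausdorff_measure_def SUP_le_iff by auto
  finally show ?thesis .
qed

lemma hausdorff_measure_eq_0_subset:
  assumes "hausdorff_measure s T = 0" "S \<subseteq> T"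
  shows "hausdorff_measure s S = 0"
  using assms(1) hausdorff_premeasure_mono[OF assms(2), of s]
  unfolding hausdorff_measure_eq_0_iff by (metis le_zero_eq)

text \<open>Choose for the \<open>i\<close>-th set a cover of weight below
  \<open>e / 2 ^ (i + 1)\<close> and merge the doubly indexed covers into one sequence by
  \<open>prod_decode\<close>. At a fixed scale \<open>\<delta>\<close> the merged family stays
  admissible.\<close>

lemma hausdorff_premeasure_UN_eq_0:
  fixes S :: "nat \<Rightarrow> 'a::metric_space set"
  assumes "\<And>i. hausdorff_premeasure s \<delta> (S i) = 0"
  shows "hausdorff_premeasure s \<delta> (\<Union>i. S i) = 0"
proof -
  have "hausdorff_premeasure s \<delta> (\<Union>i. S i) \<le> 0 + ennreal e" if "e > 0" for e
  proof -
    have "\<exists>U\<in>delta_covers \<delta> (S i). (\<Sum>j. diam_pow s (U j)) < ennreal (e * (1/2) ^ Suc i)" for i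
    proof -
      have "hausdorff_premeasure s \<delta> (S i) < ennreal (e * (1/2) ^ Suc i)"
        using assms[of i] \<open>e > 0\<close> by simp
      then show ?thesis unfolding hausdorff_premeasure_def INF_less_iff .
    qed
    then have "\<forall>i. \<exists>U. U \<in> delta_covers \<delta> (S i) \<and>
        (\<Sum>j. diam_pow s (U j)) < ennreal (e * (1/2) ^ Suc i)"
      by blast
    from choice[OF this] obtain U where U: "\<And>i. U i \<in> delta_covers \<delta> (S i)"
        "\<And>i. (\<Sum>j. diam_pow s (U i j)) < ennreal (e * (1/2) ^ Suc i)"
      by blast
    define W where "W n = (case prod_decode n of (i, j) \<Rightarrow> U i j)" for n
    have "W \<in> delta_covers \<delta> (\<Union>i. S i)"
    proof -
      have "x \<in> (\<Union>n. W n)" if x: "x \<in> S i" for x i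
      proof -
        obtain j where "x \<in> U i j" using x U(1)[of i] by (auto simp: delta_covers_def)
        then have "x \<in> W (prod_encode (i, j))" by (simp add: W_def)
        then show ?thesis by blast
      qed
      moreover have "bounded (W n) \<and> diameter (W n) \<le> \<delta>" for n
        using U(1) by (auto simp: W_def delta_covers_def split: prod.split)
      ultimately show ?thesis by (auto simp: delta_covers_def)
    qed
    then have "hausdorff_premeasure s \<delta> (\<Union>i. S i) \<le> (\<Sum>n. diam_pow s (W n))"
      unfolding hausdorff_premeasure_def by (rule INF_lower)
    also have "\<dots> = (\<Sum>i. \<Sum>j. diam_pow s (U i j))"
    proof -
      have W: "diam_pow s (W n) = (\<lambda>(i, j). diam_pow s (U i j)) (prod_decode n)" for n
        by (simp add: W_def split: prod.split)
      show ?thesis unfolding W by (rule suminf_ennreal_2dimen) simp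
    qed
    also have "\<dots> \<le> (\<Sum>i. ennreal (e * (1/2) ^ Suc i))"
      by (rule suminf_le[OF less_imp_le[OF U(2)]]) (rule summableI)+
    also have "\<dots> = ennreal e"
    proof (rule suminf_ennreal_eq)
      show "(\<lambda>i. e * (1/2) ^ Suc i) sums e"
        using sums_mult[OF power_half_series, of e] by simp
    qed (use \<open>e > 0\<close> in auto)
    finally show ?thesis by simp
  qed
  then have "hausdorff_premeasure s \<delta> (\<Union>i. S i) \<le> 0"
    by (rule ennreal_le_epsilon)
  then show ?thesis by simp
qed

lemma hausdorff_measure_UN_eq_0:
  fixes S :: "'i \<Rightarrow> 'a::metric_space set"
  assumes I: "countable I" and S: "\<And>i. i \<in> I \<Longrightarrow> hausdorff_measure s (S i) = 0"
  shows "hausdorff_measure s (\<Union>i\<in>I. S i) = 0"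
proof (cases "I = {}")
  case True
  have "hausdorff_premeasure s \<delta> ({}::'a set) \<le> (\<Sum>i\<in>({}::nat set). diam_pow s ({}::'a set))" if "\<delta> > 0" for \<delta>
    by (rule hausdorff_premeasure_le_finite_cover) (use that in auto)
  then show ?thesis by (simp add: True hausdorff_measure_eq_0_iff)
next
  case False
  have "hausdorff_premeasure s \<delta> (\<Union>n. S (from_nat_into I n)) = 0" if "\<delta> > 0" for \<delta>
    using S[OF from_nat_into[OF False]] that
    by (intro hausdorff_premeasure_UN_eq_0) (auto simp: hausdorff_measure_eq_0_iff)
  moreover have "(\<Union>n. S (from_nat_into I n)) = (\<Union>i\<in>I. S i)"
    using range_from_nat_into[OF False I] by (metis image_image)
  ultimately show ?thesis by (simp add: hausdorff_measure_eq_0_iff)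
qed

lemma hausdorff_measure_singleton:
  assumes "s > 0"
  shows "hausdorff_measure s {x} = 0"
proof -
  have "hausdorff_premeasure s \<delta> {x} \<le> (\<Sum>i\<in>{0::nat}. diam_pow s {x})" if "\<delta> > 0" for \<delta>
    by (rule hausdorff_premeasure_le_finite_cover) (use that in auto)
  then show ?thesis using assms by (simp add: hausdorff_measure_eq_0_iff diam_pow_def)
qed

section \<open>Bounding the dimension from above and from below\<close>

lemma hausdorff_dim_le:
  assumes "0 \<le> t" and "\<And>s. t < s \<Longrightarrow> hausdorff_measure s S = 0"
  shows "hausdorff_dim S \<le> ereal t"
proof (rule ereal_le_epsilon2)
  fix e :: real assume "0 < e"
  then have "ereal (t + e) \<in> ereal ` {s. 0 \<le> s \<and> hausdorff_measure s S = 0}"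
    using assms by auto
  then show "hausdorff_dim S \<le> ereal t + ereal e"
    unfolding hausdorff_dim_def by (simp add: Inf_lower)
qed

lemma hausdorff_measure_neq_0_if_less_dim:
  assumes "0 \<le> s" "ereal s < hausdorff_dim S"
  shows "hausdorff_measure s S \<noteq> 0"
proof
  assume "hausdorff_measure s S = 0"
  then have "hausdorff_dim S \<le> ereal s"
    unfolding hausdorff_dim_def using assms(1) by (intro Inf_lower) auto
  then show False using assms(2) by simp
qed

text \<open>Covers of \<open>F\<close> pull back to covers of the unit interval, whose Lebesgue measure is 1.\<close>

lemma hausdorff_dim_ge_if_inverse_hoelder:
  fixes X :: "real \<Rightarrow> 'a::metric_space"
  assumes "s > 0" and F: "X ` {0..<1} \<subseteq> F"
    and X: "\<And>y z. \<lbrakk>y \<in> {0..<1}; z \<in> {0..<1}\<rbrakk> \<Longrightarrow> \<bar>y - z\<bar> \<le> C * dist (X y) (X z) powr s"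
  shows "ereal s \<le> hausdorff_dim F"
proof -
  have C: "0 < C"
  proof (rule ccontr)
    assume "\<not> 0 < C"
    then have "C * dist (X 0) (X (1/2)) powr s \<le> 0" by (simp add: mult_nonpos_nonneg)
    with X[of 0 "1/2"] show False by simp
  qed
  \<comment> \<open>Covers at scale 1 suffice: for diameters at most 1 the weight only grows when
    the exponent drops from \<open>s\<close> to \<open>t\<close>, so one bound excludes measure 0
    for all \<open>t \<le> s\<close>.\<close>
  have *: "1 \<le> ennreal C * (\<Sum>i. diam_pow t (U i))"
    if t: "0 \<le> t" "t \<le> s" and U: "U \<in> delta_covers 1 F" for t U
  proof -
    define V where "V i = {y\<in>{0..<1}. X y \<in> U i}" for i
    have bV: "bounded (U i)" "diameter (U i) \<le> 1" for i
      using U by (auto simp: delta_covers_def)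
    \<comment> \<open>\<open>V i\<close> need not be measurable, so it is enclosed in the interval
      from its infimum to its supremum, whose length obeys the same bound \<open>d\<close>.\<close>
    have "\<exists>W. W \<in> sets lborel \<and> V i \<subseteq> W \<and> emeasure lborel W \<le> ennreal C * diam_pow t (U i)" for i
    proof (cases "V i = {}")
      case True
      then show ?thesis by (intro exI[of _ "{}"]) auto
    next
      case False
      define d where "d = C * diameter (U i) powr s"
      have d: "\<bar>y - z\<bar> \<le> d" if "y \<in> V i" "z \<in> V i" for y z
      proof -
        have "\<bar>y - z\<bar> \<le> C * dist (X y) (X z) powr s"
          using X that by (auto simp: V_def)
        also have "\<dots> \<le> d" unfolding d_def
          using that C \<open>s > 0\<close> diameter_bounded_bound[OF bV(1)]
          by (intro mult_left_mono powr_mono2) (auto simp: V_def)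
        finally show ?thesis .
      qed
      have bd: "bdd_below (V i)" "bdd_above (V i)"
        by (rule bdd_belowI[of _ 0], simp add: V_def) (rule bdd_aboveI[of _ 1], simp add: V_def)
      have le: "Sup (V i) - Inf (V i) \<le> d"
      proof -
        have "Sup (V i) \<le> Inf (V i) + d"
        proof (rule cSup_least[OF False])
          fix y assume y: "y \<in> V i"
          have "y - d \<le> Inf (V i)"
            by (rule cInf_greatest[OF False]) (use d[OF y] in force)
          then show "y \<le> Inf (V i) + d" by simp
        qed
        then show ?thesis by simp
      qed
      have sub: "V i \<subseteq> {Inf (V i)..Sup (V i)}"
        using bd by (auto intro: cInf_lower cSup_upper)
      have nonempty: "U i \<noteq> {}" using False by (auto simp: V_def)
      have "ennreal (diameter (U i) powr s) \<le> diam_pow t (U i)"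
      proof (cases "t = 0")
        case True
        have "diameter (U i) powr s \<le> 1"
          using bV[of i] diameter_ge_0[OF bV(1)[of i]] \<open>s > 0\<close> by (intro powr_le1) auto
        with True nonempty show ?thesis by (simp add: diam_pow_def)
      next
        case False
        have "diameter (U i) powr s \<le> diameter (U i) powr t"
          using bV[of i] diameter_ge_0[OF bV(1)[of i]] t by (intro powr_mono') auto
        with False nonempty show ?thesis by (simp add: diam_pow_def ennreal_leI)
      qed
      then have "ennreal d \<le> ennreal C * diam_pow t (U i)"
        using C by (simp add: d_def ennreal_mult mult_left_mono)
      moreover have "emeasure lborel {Inf (V i)..Sup (V i)} \<le> ennreal d"
        using le sub False by (subst emeasure_lborel_Icc) (auto intro: ennreal_leI)
      ultimately have "emeasure lborel {Inf (V i)..Sup (V i)} \<le> ennreal C * diam_pow t (U i)"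
        by (rule order_trans[rotated])
      then show ?thesis using sub by (intro exI[of _ "{Inf (V i)..Sup (V i)}"]) auto
    qed
    then obtain W where W: "\<And>i. W i \<in> sets lborel" "\<And>i. V i \<subseteq> W i"
        "\<And>i. emeasure lborel (W i) \<le> ennreal C * diam_pow t (U i)"
      by metis
    have "{0..<1::real} \<subseteq> (\<Union>i. W i)"
    proof
      fix y :: real assume y: "y \<in> {0..<1}"
      then have "X y \<in> F" using F by blast
      then obtain i where "X y \<in> U i" using U by (auto simp: delta_covers_def)
      then show "y \<in> (\<Union>i. W i)" using y W(2)[of i] by (auto simp: V_def)
    qed
    then have "emeasure lborel {0..<1::real} \<le> emeasure lborel (\<Union>i. W i)"
      using W(1) by (intro emeasure_mono) auto
    also have "\<dots> \<le> (\<Sum>i. emeasure lborel (W i))"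
      using W(1) by (intro emeasure_subadditive_countably) auto
    also have "\<dots> \<le> (\<Sum>i. ennreal C * diam_pow t (U i))"
      by (intro suminf_le W(3)) auto
    also have "\<dots> = ennreal C * (\<Sum>i. diam_pow t (U i))"
      by simp
    finally show ?thesis by simp
  qed
  show ?thesis unfolding hausdorff_dim_def
  proof (rule Inf_greatest)
    fix x assume "x \<in> ereal ` {t. 0 \<le> t \<and> hausdorff_measure t F = 0}"
    then obtain t where t: "x = ereal t" "0 \<le> t" "hausdorff_measure t F = 0" by auto
    show "ereal s \<le> x"
    proof (rule ccontr)
      assume "\<not> ereal s \<le> x"
      then have "t \<le> s" using t by simp
      have "hausdorff_premeasure t 1 F < ennreal (1 / C)"
        using t(3) C by (simp add: hausdorff_measure_eq_0_iff)
      then obtain U where U: "U \<in> delta_covers 1 F" "(\<Sum>i. diam_pow t (U i)) < ennreal (1 / C)"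
        unfolding hausdorff_premeasure_def INF_less_iff by blast
      have "1 \<le> ennreal C * (\<Sum>i. diam_pow t (U i))" using * t(2) \<open>t \<le> s\<close> U(1) by blast
      also have "\<dots> < ennreal C * ennreal (1 / C)"
        using U(2) C by (intro ennreal_mult_strict_left_mono) auto
      also have "\<dots> = 1" using C by (simp flip: ennreal_mult)
      finally show False by simp
    qed
  qed
qed

section \<open>The upper bound\<close>

lemma card_pieces_ge:
  fixes B :: "real set"
  assumes h: "h > 0" "h \<le> \<delta>" and "s > 0"
    and cov: "B \<subseteq> (\<Union>i<n. {a + real i * h..a + real (Suc i) * h})"
    and c: "ennreal c \<le> hausdorff_premeasure s \<delta> B" "0 \<le> c"
  shows "c \<le> real (card {i\<in>{..<n}. B \<inter> {a + real i * h..a + real (Suc i) * h} \<noteq> {}}) * h powr s"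
proof -
  let ?U = "\<lambda>i. {a + real i * h..a + real (Suc i) * h}"
  let ?I = "{i\<in>{..<n}. B \<inter> ?U i \<noteq> {}}"
  \<comment> \<open>The pieces meeting \<open>B\<close> already cover it, and each has diameter
    \<open>h \<le> \<delta>\<close> and weight \<open>h powr s\<close>.\<close>
  have cov': "B \<subseteq> (\<Union>i\<in>?I. ?U i)" using cov by blast
  have "ennreal c \<le> (\<Sum>i\<in>?I. diam_pow s (?U i))"
    by (rule order_trans[OF c(1)], rule hausdorff_premeasure_le_finite_cover[OF _ cov'])
      (use h in \<open>auto simp: algebra_simps\<close>)
  also have "\<dots> = (\<Sum>i\<in>?I. ennreal (h powr s))"
    using h \<open>s > 0\<close> by (intro sum.cong) (auto simp: diam_pow_def algebra_simps)
  also have "\<dots> = ennreal (real (card ?I) * h powr s)"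
    by (simp add: ennreal_mult ennreal_of_nat_eq_real_of_nat)
  finally show ?thesis by (simp add: ennreal_le_iff)
qed

text \<open>
  Double counting of the incidences between \<open>n\<close> equal pieces of the domain and the cells of a grid
  whose mesh is the oscillation of \<open>f\<close> on a piece: a piece meets at most two cells, whereas a cell
  containing a point of \<open>Y\<close> meets at least \<open>c * h powr - \<beta>\<close> pieces.
\<close>

lemma hausdorff_premeasure_thick_fibres_le:
  fixes f :: "real \<Rightarrow> real"
  assumes ab: "a < b" and B: "B \<subseteq> {a..b}" and C: "C > 0" and c: "c > 0"
    and f: "\<And>x y. \<lbrakk>x \<in> B; y \<in> B\<rbrakk> \<Longrightarrow> \<bar>f x - f y\<bar> \<le> C * \<bar>x - y\<bar> ^ k"
    and "\<beta> > 0" and "s > 0" and n: "n > 0"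
    and h_def: "h = (b - a) / real n" and h\<delta>: "h \<le> \<delta>" and h\<delta>': "C * h ^ k \<le> \<delta>'"
    and Y_def: "Y = {y. ennreal c \<le> hausdorff_premeasure \<beta> \<delta> (B \<inter> f -` {y})}"
  shows "hausdorff_premeasure s \<delta>' Y \<le> ennreal (2 * real n * h powr \<beta> / c * (C * h ^ k) powr s)"
proof -
  define \<eta> where "\<eta> = C * h ^ k"
  have h: "h > 0" using ab n by (simp add: h_def)
  have \<eta>: "\<eta> > 0" using C h by (simp add: \<eta>_def)
  define U where "U i = {a + real i * h..a + real (Suc i) * h}" for i
  have cov: "B \<subseteq> (\<Union>i<n. U i)"
  proof
    fix x assume "x \<in> B"
    then have x: "a \<le> x" "x \<le> b" using B by auto
    \<comment> \<open>For \<open>x = b\<close> the floor formula would give the index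
      \<open>n\<close>, one too many; the last piece is closed and contains this endpoint.\<close>
    show "x \<in> (\<Union>i<n. U i)"
    proof (cases "x = b")
      case True
      have "real (n - 1) + 1 = real n" using n by simp
      then have "x = a + real (Suc (n - 1)) * h" using True n by (simp add: h_def)
      moreover have "a + real (n - 1) * h \<le> a + real (Suc (n - 1)) * h" using h by simp
      ultimately have "x \<in> U (n - 1)" by (simp add: U_def)
      then show ?thesis using n by (intro UN_I[of "n - 1"]) auto
    next
      case False
      define i where "i = nat \<lfloor>(x - a) / h\<rfloor>"
      have pos: "0 \<le> (x - a) / h" using x h by simp
      have i: "real i \<le> (x - a) / h" "(x - a) / h < real i + 1"
        using pos by (auto simp: i_def)
      have "(x - a) / h < real n" using x False h n ab by (simp add: h_def field_simps)
      then have "i < n" using i by linarith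
      moreover have "x \<in> U i" using i h by (simp add: U_def field_simps)
      ultimately show ?thesis by blast
    qed
  qed
  define cell where "cell x = \<lfloor>f x / \<eta>\<rfloor>" for x
  define T where "T = (\<lambda>y. \<lfloor>y / \<eta>\<rfloor>) ` Y"
  \<comment> \<open>The incidence relation between pieces and the cells that \<open>f\<close>
    reaches from them. It is counted by pieces in \<open>cell2\<close> and by cells in
    \<open>row\<close>.\<close>
  define P where "P = (SIGMA i:{..<n}. cell ` (B \<inter> U i))"
  have close: "\<bar>cell x - cell y\<bar> \<le> 1" if "x \<in> B \<inter> U i" "y \<in> B \<inter> U i" for x y i
  proof -
    have "\<bar>x - y\<bar> \<le> h" using that by (auto simp: U_def algebra_simps)
    then have "\<bar>f x - f y\<bar> \<le> \<eta>"
      using f[of x y] that C unfolding \<eta>_def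
      by (meson IntD1 abs_ge_zero less_imp_le mult_left_mono order_trans power_mono)
    then have "\<bar>f x / \<eta> - f y / \<eta>\<bar> \<le> 1" using \<eta> by (simp flip: diff_divide_distrib)
    then show ?thesis unfolding cell_def by linarith
  qed
  have cell2: "finite (cell ` (B \<inter> U i)) \<and> card (cell ` (B \<inter> U i)) \<le> 2" for i
  proof (cases "B \<inter> U i = {}")
    case False
    let ?S = "cell ` (B \<inter> U i)"
    obtain x0 where x0: "x0 \<in> B \<inter> U i" using False by blast
    have "?S \<subseteq> {cell x0 - 1..cell x0 + 1}"
      using close[OF x0] by (force simp: abs_le_iff)
    then have fin: "finite ?S" by (rule finite_subset) simp
    \<comment> \<open>Seen from the lowest cell, closeness leaves only this cell and the next; seen
      from an arbitrary cell it would leave three.\<close>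
    have "Min ?S \<in> ?S" using fin False by (intro Min_in) auto
    then obtain x1 where x1: "x1 \<in> B \<inter> U i" "cell x1 = Min ?S" by auto
    have "?S \<subseteq> {cell x1, cell x1 + 1}"
    proof
      fix z assume z: "z \<in> ?S"
      then obtain x where "x \<in> B \<inter> U i" "z = cell x" by blast
      moreover have "cell x1 \<le> z" using fin z x1 by simp
      ultimately show "z \<in> {cell x1, cell x1 + 1}" using close[OF x1(1), of x] by auto
    qed
    then have "card ?S \<le> card {cell x1, cell x1 + 1}" by (intro card_mono) auto
    then show ?thesis using fin by simp
  qed simp
  have finP: "finite P" unfolding P_def using cell2 by auto
  have cardP: "card P \<le> 2 * n"
  proof -
    have "card P = (\<Sum>i<n. card (cell ` (B \<inter> U i)))"
      unfolding P_def using cell2 by (intro card_SigmaI) auto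
    also have "\<dots> \<le> (\<Sum>i<n. 2)" using cell2 by (intro sum_mono) auto
    finally show ?thesis by simp
  qed
  have row: "c \<le> real (card {p\<in>P. snd p = z}) * h powr \<beta>" if z: "z \<in> T" for z
  proof -
    obtain y where y: "y \<in> Y" "z = \<lfloor>y / \<eta>\<rfloor>" using z by (auto simp: T_def)
    let ?I = "{i\<in>{..<n}. (B \<inter> f -` {y}) \<inter> {a + real i * h..a + real (Suc i) * h} \<noteq> {}}"
    have "c \<le> real (card ?I) * h powr \<beta>"
      by (rule card_pieces_ge[OF h h\<delta> \<open>\<beta> > 0\<close>])
        (use cov y c in \<open>auto simp: U_def Y_def\<close>)
    also have "card ?I \<le> card {p\<in>P. snd p = z}"
    proof -
      have "(\<lambda>i. (i, z)) ` ?I \<subseteq> {p\<in>P. snd p = z}"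
        unfolding P_def cell_def U_def y(2) by auto
      then have "card ((\<lambda>i. (i, z)) ` ?I) \<le> card {p\<in>P. snd p = z}"
        using finP by (intro card_mono) auto
      then show ?thesis by (subst (asm) card_image) (auto simp: inj_on_def)
    qed
    finally show ?thesis by (simp add: mult_right_mono)
  qed
  have "T \<subseteq> snd ` P"
  proof
    fix z assume z: "z \<in> T"
    have "{p\<in>P. snd p = z} \<noteq> {}"
    proof
      assume "{p\<in>P. snd p = z} = {}"
      then show False using row[OF z] c by (metis card.empty mult_zero_left not_le of_nat_0)
    qed
    then obtain p where "p \<in> P" "snd p = z" by blast
    then show "z \<in> snd ` P" by blast
  qed
  then have finT: "finite T" using finP by (meson finite_imageI finite_subset)
  have "real (card T) * c \<le> (\<Sum>z\<in>T. real (card {p\<in>P. snd p = z}) * h powr \<beta>)"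
    using sum_mono[of T "\<lambda>_. c", OF row] by simp
  also have "\<dots> = real (\<Sum>z\<in>T. card {p\<in>P. snd p = z}) * h powr \<beta>"
    by (simp add: sum_distrib_right)
  also have "(\<Sum>z\<in>T. card {p\<in>P. snd p = z}) = card (\<Union>z\<in>T. {p\<in>P. snd p = z})"
    using finP finT by (intro card_UN_disjoint[symmetric]) auto
  also have "\<dots> \<le> 2 * n"
    by (rule order_trans[OF card_mono[OF finP] cardP]) blast
  finally have cardT: "real (card T) \<le> 2 * real n * h powr \<beta> / c"
    using c by (simp add: field_simps mult_right_mono)
  let ?V = "\<lambda>z::int. {real_of_int z * \<eta>..(real_of_int z + 1) * \<eta>}"
  have "hausdorff_premeasure s \<delta>' Y \<le> (\<Sum>z\<in>T. diam_pow s (?V z))"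
  proof (rule hausdorff_premeasure_le_finite_cover[OF finT])
    show "Y \<subseteq> (\<Union>z\<in>T. ?V z)"
    proof
      fix y assume "y \<in> Y"
      then have "\<lfloor>y / \<eta>\<rfloor> \<in> T" by (simp add: T_def)
      moreover have "y \<in> ?V \<lfloor>y / \<eta>\<rfloor>"
      proof -
        have "of_int \<lfloor>y / \<eta>\<rfloor> * \<eta> \<le> y / \<eta> * \<eta>" "y / \<eta> * \<eta> \<le> (of_int \<lfloor>y / \<eta>\<rfloor> + 1) * \<eta>"
          using \<eta> by (intro mult_right_mono; linarith)+
        then show ?thesis using \<eta> by simp
      qed
      ultimately show "y \<in> (\<Union>z\<in>T. ?V z)" by blast
    qed
    show "bounded (?V z) \<and> diameter (?V z) \<le> \<delta>'" for z
      using \<eta> h\<delta>' by (auto simp: \<eta>_def algebra_simps)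
    show "0 \<le> \<delta>'" using \<eta> h\<delta>' by (simp add: \<eta>_def)
  qed
  also have "\<dots> = (\<Sum>z\<in>T. ennreal (\<eta> powr s))"
    using \<eta> \<open>s > 0\<close> by (intro sum.cong) (auto simp: diam_pow_def algebra_simps)
  also have "\<dots> = ennreal (real (card T) * \<eta> powr s)"
    by (simp add: ennreal_mult ennreal_of_nat_eq_real_of_nat)
  also have "\<dots> \<le> ennreal (2 * real n * h powr \<beta> / c * \<eta> powr s)"
    using cardT by (intro ennreal_leI mult_right_mono) auto
  finally show ?thesis by (simp add: \<eta>_def)
qed

text \<open>For \<open>h = (b - a) / n\<close> the preceding bound is a constant times
  \<open>h powr (k * s + \<beta> - 1)\<close>, which tends to 0 as \<open>n\<close> grows. Meanwhile
  \<open>c\<close> and \<open>\<delta>\<close> stay fixed: the counting relies on thresholds that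
  are uniform over all fibres considered.\<close>

lemma hausdorff_measure_thick_fibres_eq_0:
  fixes f :: "real \<Rightarrow> real"
  assumes ab: "a < b" and B: "B \<subseteq> {a..b}" and C: "C > 0" and c: "c > 0" and \<delta>: "\<delta> > 0"
    and f: "\<And>x y. \<lbrakk>x \<in> B; y \<in> B\<rbrakk> \<Longrightarrow> \<bar>f x - f y\<bar> \<le> C * \<bar>x - y\<bar> ^ k"
    and "\<beta> > 0" and "s > 0" and k: "k \<ge> 1" and s: "real k * s + \<beta> > 1"
  shows "hausdorff_measure s {y. ennreal c \<le> hausdorff_premeasure \<beta> \<delta> (B \<inter> f -` {y})} = 0"
    (is "hausdorff_measure s ?Y = 0")
  unfolding hausdorff_measure_eq_0_iff
proof (intro allI impI)
  fix \<delta>' :: real assume \<delta>': "\<delta>' > 0"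
  define h where "h n = (b - a) / real n" for n
  define bd where "bd n = 2 * real n * h n powr \<beta> / c * (C * h n ^ k) powr s" for n
  have h0: "h \<longlonglongrightarrow> 0" unfolding h_def by (rule lim_const_over_n)
  have hk0: "(\<lambda>n. C * h n ^ k) \<longlonglongrightarrow> 0"
    using tendsto_mult_left[OF tendsto_power[OF h0, of k], of C] k by (simp add: zero_power)
  have bd_eq: "bd n = 2 * (b - a) * C powr s / c * h n powr (real k * s + \<beta> - 1)"
    if "n > 0" for n
  proof -
    have hn: "h n > 0" using that ab by (simp add: h_def)
    have n: "real n = (b - a) / h n" using that ab by (simp add: h_def)
    have e1: "(C * h n ^ k) powr s = C powr s * h n powr (real k * s)"
      using hn C by (simp add: powr_mult powr_powr flip: powr_realpow)
    have e2: "h n powr (real k * s + \<beta> - 1) = h n powr (real k * s) * h n powr \<beta> / h n"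
      using hn by (simp add: powr_add powr_diff)
    show ?thesis unfolding bd_def e1 e2 n by (simp add: mult_ac)
  qed
  have "(\<lambda>n. 2 * (b - a) * C powr s / c * h n powr (real k * s + \<beta> - 1)) \<longlonglongrightarrow>
      2 * (b - a) * C powr s / c * 0 powr (real k * s + \<beta> - 1)"
    by (intro tendsto_intros tendsto_powr2 h0) (use ab s in \<open>auto simp: h_def\<close>)
  then have "(\<lambda>n. 2 * (b - a) * C powr s / c * h n powr (real k * s + \<beta> - 1)) \<longlonglongrightarrow> 0"
    by simp
  moreover have "eventually (\<lambda>n. 2 * (b - a) * C powr s / c * h n powr (real k * s + \<beta> - 1) = bd n)
      sequentially"
    using eventually_gt_at_top[of 0] by eventually_elim (simp add: bd_eq)
  ultimately have "bd \<longlonglongrightarrow> 0" by (rule Lim_transform_eventually)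
  then have lim: "(\<lambda>n. ennreal (bd n)) \<longlonglongrightarrow> 0"
    by (metis ennreal_0 tendsto_ennrealI)
  have "eventually (\<lambda>n. hausdorff_premeasure s \<delta>' ?Y \<le> ennreal (bd n)) sequentially"
    using order_tendstoD(2)[OF h0 \<delta>] order_tendstoD(2)[OF hk0 \<delta>'] eventually_gt_at_top[of 0]
  proof eventually_elim
    case (elim n)
    show ?case unfolding bd_def
      by (rule hausdorff_premeasure_thick_fibres_le[OF ab B C c f \<open>\<beta> > 0\<close> \<open>s > 0\<close> _ h_def _ _ refl])
        (use elim in auto)
  qed
  then have "hausdorff_premeasure s \<delta>' ?Y \<le> 0"
    by (intro tendsto_lowerbound[OF lim]) auto
  then show "hausdorff_premeasure s \<delta>' ?Y = 0" by simp
qed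

section \<open>Flatness at accumulation points of level sets\<close>

text \<open>Continuity carries the value \<open>c\<close> over to the limit point. Rolle's theorem,
  here via the mean value theorem, then puts a zero of the derivative strictly between
  \<open>x\<close> and each nearby point of the level set; these zeros differ from \<open>x\<close>
  and accumulate there.\<close>

lemma islimpt_deriv_zeros:
  fixes g :: "real \<Rightarrow> real"
  assumes E: "open E" "x \<in> E" and g: "\<And>t. t \<in> E \<Longrightarrow> g field_differentiable at t"
    and x: "x islimpt {t\<in>E. g t = c}"
  shows "g x = c" and "x islimpt {t\<in>E. deriv g t = 0}"
proof -
  show gx: "g x = c"
  proof (rule ccontr)
    assume "g x \<noteq> c"
    moreover have "continuous (at x) g"
      using g[OF E(2)] by (rule field_differentiable_imp_continuous_at)
    ultimately obtain e where e: "e > 0" "\<And>t. dist x t < e \<Longrightarrow> g t \<noteq> c"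
      using continuous_at_avoid by blast
    then obtain t where "t \<in> E" "g t = c" "dist t x < e"
      using x unfolding islimpt_approachable by blast
    then show False using e(2)[of t] by (simp add: dist_commute)
  qed
  obtain r where r: "r > 0" "ball x r \<subseteq> E" using E by (meson openE)
  have D: "(g has_real_derivative deriv g t) (at t)" if "t \<in> E" for t
    using g[OF that] by (simp add: DERIV_deriv_iff_field_differentiable)
  show "x islimpt {t\<in>E. deriv g t = 0}"
    unfolding islimpt_approachable
  proof (intro allI impI)
    fix e :: real assume "e > 0"
    then have "min e r > 0" using r(1) by simp
    then obtain t where t: "t \<noteq> x" "g t = c" "dist t x < min e r"
      using x unfolding islimpt_approachable by blast
    have "{min t x..max t x} \<subseteq> ball x r"
    proof
      fix u assume "u \<in> {min t x..max t x}"
      moreover have "\<bar>t - x\<bar> < r" using t(3) by (simp add: dist_real_def)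
      ultimately show "u \<in> ball x r" by (auto simp: dist_real_def abs_if split: if_splits)
    qed
    then have sub: "{min t x..max t x} \<subseteq> E" using r(2) by blast
    have "min t x < max t x" using t(1) by (auto simp: min_def max_def)
    have "(g has_real_derivative deriv g u) (at u)" if "min t x \<le> u" "u \<le> max t x" for u
      by (rule D) (use sub that in auto)
    from MVT2[OF \<open>min t x < max t x\<close> this] obtain z where
      z: "min t x < z" "z < max t x"
         "g (max t x) - g (min t x) = (max t x - min t x) * deriv g z"
      by blast
    have "g (max t x) = g (min t x)" using t(2) gx by (simp add: min_def max_def)
    then have "deriv g z = 0" using z(3) \<open>min t x < max t x\<close> by simp
    moreover have "z \<in> E" using sub z by auto
    moreover have "z \<noteq> x" "dist z x < e"
      using z t by (auto simp: dist_real_def min_def max_def split: if_splits)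
    ultimately show "\<exists>z\<in>{t\<in>E. deriv g t = 0}. z \<noteq> x \<and> dist z x < e" by blast
  qed
qed

text \<open>Repeated use of Rolle makes \<open>x\<close> a limit point of zeros of each derivative
  of order 1 to \<open>k\<close>. Concluding that the derivative vanishes at \<open>x\<close> itself
  uses its differentiability, hence \<open>j < k\<close>.\<close>

lemma level_set_accumulation_derivs_0:
  assumes f: "f \<in> C_k k E" and E: "open E" "x \<in> E"
    and x: "x islimpt level_set E f (f x)" and j: "1 \<le> j" "j < k"
  shows "(deriv ^^ j) f x = 0"
proof -
  have df: "(deriv ^^ i) f field_differentiable at t" if "i < k" "t \<in> E" for i t
    using f that by (auto simp: C_k_def)
  have "x islimpt {t\<in>E. (deriv ^^ Suc i) f t = 0}" if "Suc i \<le> k" for i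
    using that
  proof (induction i)
    case 0
    then show ?case
      using islimpt_deriv_zeros(2)[of E x f "f x"] E x df[of 0]
      by (simp add: level_set_def)
  next
    case (Suc i)
    then show ?case
      using islimpt_deriv_zeros(2)[of E x "(deriv ^^ Suc i) f" 0] E df[of "Suc i"] by simp
  qed
  moreover obtain i where "j = Suc i" using j by (cases j) auto
  ultimately have "x islimpt {t\<in>E. (deriv ^^ j) f t = 0}" using j by simp
  then show ?thesis by (rule islimpt_deriv_zeros(1)[OF E, rotated]) (rule df[OF j(2)])
qed

text \<open>In Taylor's formula at \<open>x\<close> the terms of order 1 to \<open>k - 1\<close>
  vanish, which leaves the Lagrange remainder. A bound of the \<open>k\<close>-th derivative on the
  compact interval gives one constant for all such \<open>x\<close>.\<close>

lemma C_k_flat_at_level_set_accumulation: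
  assumes f: "f \<in> C_k k E" and k: "k \<ge> 1" and E: "open E" and ab: "{a..b} \<subseteq> E"
  obtains C where "C > 0"
    "\<And>x z. \<lbrakk>x \<in> {a..b}; x islimpt level_set E f (f x); z \<in> {a..b}\<rbrakk>
      \<Longrightarrow> \<bar>f z - f x\<bar> \<le> C * \<bar>z - x\<bar> ^ k"
proof -
  have "continuous_on {a..b} ((deriv ^^ k) f)"
    using f ab by (auto simp: C_k_def intro: continuous_on_subset)
  then have "bounded ((deriv ^^ k) f ` {a..b})"
    by (intro compact_imp_bounded compact_continuous_image) auto
  then obtain M where M: "M > 0" "\<And>t. t \<in> {a..b} \<Longrightarrow> \<bar>(deriv ^^ k) f t\<bar> \<le> M"
    unfolding bounded_pos by auto
  show thesis
  proof (rule that[OF M(1)])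
    fix x z assume x: "x \<in> {a..b}" "x islimpt level_set E f (f x)" and z: "z \<in> {a..b}"
    show "\<bar>f z - f x\<bar> \<le> M * \<bar>z - x\<bar> ^ k"
    proof (cases "z = x")
      case True
      then show ?thesis using M(1) by simp
    next
      case False
      have D: "((deriv ^^ m) f has_real_derivative (deriv ^^ Suc m) f t) (at t)"
        if "m < k" "a \<le> t" "t \<le> b" for m t
      proof -
        have "t \<in> E" using that ab by auto
        then show ?thesis using f that
          by (auto simp: C_k_def DERIV_deriv_iff_field_differentiable)
      qed
      have "\<exists>t. (if z < x then z < t \<and> t < x else x < t \<and> t < z) \<and>
          f z = (\<Sum>m<k. (deriv ^^ m) f x / fact m * (z - x) ^ m) +
                (deriv ^^ k) f t / fact k * (z - x) ^ k"
        by (rule Taylor[of k "\<lambda>m. (deriv ^^ m) f" f a b])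
          (use k D x(1) z False in auto)
      then obtain t where t': "if z < x then z < t \<and> t < x else x < t \<and> t < z" and eq:
          "f z = (\<Sum>m<k. (deriv ^^ m) f x / fact m * (z - x) ^ m) +
                (deriv ^^ k) f t / fact k * (z - x) ^ k"
        by blast
      have t: "t \<in> {a..b}" using t' x(1) z by (auto split: if_splits)
      have "(\<Sum>m<k. (deriv ^^ m) f x / fact m * (z - x) ^ m) =
          (\<Sum>m<k. if m = 0 then f x else 0)"
        using level_set_accumulation_derivs_0[OF f E _ x(2)] ab x(1)
        by (intro sum.cong) auto
      also have "\<dots> = f x" using k by (simp add: sum.delta)
      finally have "f z - f x = (deriv ^^ k) f t / fact k * (z - x) ^ k" using eq by simp
      then have "\<bar>f z - f x\<bar> = \<bar>(deriv ^^ k) f t\<bar> / fact k * \<bar>z - x\<bar> ^ k"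
        by (simp add: abs_mult power_abs)
      also have "\<dots> \<le> M * \<bar>z - x\<bar> ^ k"
      proof (rule mult_right_mono)
        have "\<bar>(deriv ^^ k) f t\<bar> / fact k \<le> \<bar>(deriv ^^ k) f t\<bar>"
          by (simp add: divide_le_eq mult_le_cancel_left1)
        then show "\<bar>(deriv ^^ k) f t\<bar> / fact k \<le> M" using M(2)[OF t] by linarith
      qed simp
      finally show ?thesis .
    qed
  qed
qed

section \<open>Covering the exceptional values by countably many null sets\<close>

text \<open>The counting argument needs a compact interval, flatness and uniform thresholds.
  Rational intervals \<open>p\<close> and thresholds \<open>1 / (N + 1)\<close> supply countably
  many such situations, whose null sets \<open>Y p N\<close> together contain
  \<open>I_set E \<alpha> f\<close>.\<close>

lemma L_dim_le:
  assumes k: "k \<ge> 1" and \<alpha>: "0 < \<alpha>" "\<alpha> < 1" and E: "open E" and f: "f \<in> C_k k E"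
  shows "L_dim E \<alpha> f \<le> ereal ((1 - \<alpha>) / real k)"
  unfolding L_dim_def
proof (rule hausdorff_dim_le)
  show "0 \<le> (1 - \<alpha>) / real k" using \<alpha> by simp
  fix s assume s: "(1 - \<alpha>) / real k < s"
  then have "s > 0" using \<open>0 \<le> (1 - \<alpha>) / real k\<close> by linarith
  have ks: "1 - \<alpha> < real k * s" using s k by (simp add: field_simps)
  \<comment> \<open>\<open>\<beta> < \<alpha>\<close> gives the fibres nonzero
    \<open>\<beta>\<close>-measure, \<open>\<beta> > 1 - k * s\<close> makes the counting exponent
    positive, and \<open>\<beta> > 0\<close> makes single points null.\<close>
  obtain \<beta> where \<beta>: "max 0 (1 - real k * s) < \<beta>" "\<beta> < \<alpha>"
    using dense[of "max 0 (1 - real k * s)" \<alpha>] ks \<alpha> by auto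
  define A where "A = {x\<in>E. x islimpt level_set E f (f x)}"
  define J where "J = {(a, b) \<in> \<rat> \<times> \<rat>. a < b \<and> {a..b} \<subseteq> E}"
  have J: "countable J"
    by (rule countable_subset[of _ "\<rat> \<times> \<rat>"]) (auto simp: J_def countable_rat)
  have nearby: "\<exists>p\<in>J. x \<in> {fst p<..<snd p} \<and> {fst p..snd p} \<subseteq> U"
    if U: "x \<in> U" "open U" "U \<subseteq> E" for x U
  proof -
    obtain e where e: "e > 0" "ball x e \<subseteq> U" using U by (meson openE)
    obtain a where a: "a \<in> \<rat>" "x - e < a" "a < x" using Rats_dense_in_real[of "x - e" x] e by auto
    obtain b where b: "b \<in> \<rat>" "x < b" "b < x + e" using Rats_dense_in_real[of x "x + e"] e by auto
    have "{a..b} \<subseteq> ball x e" using a b by (auto simp: dist_real_def)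
    then have "{a..b} \<subseteq> U" using e by blast
    then show ?thesis using a b \<open>U \<subseteq> E\<close> by (intro bexI[of _ "(a, b)"]) (auto simp: J_def)
  qed
  define Y where "Y p N = {y. ennreal (1 / real (Suc N)) \<le>
      hausdorff_premeasure \<beta> (1 / real (Suc N)) (A \<inter> {fst p..snd p} \<inter> f -` {y})}" for p N
  have Y0: "hausdorff_measure s (Y p N) = 0" if p: "p \<in> J" for p N
  proof -
    have ab: "fst p < snd p" "{fst p..snd p} \<subseteq> E" using p by (auto simp: J_def)
    obtain C where C: "C > 0" "\<And>x z. \<lbrakk>x \<in> {fst p..snd p}; x islimpt level_set E f (f x);
        z \<in> {fst p..snd p}\<rbrakk> \<Longrightarrow> \<bar>f z - f x\<bar> \<le> C * \<bar>z - x\<bar> ^ k"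
      using C_k_flat_at_level_set_accumulation[OF f k E ab(2)] by blast
    show ?thesis unfolding Y_def
      by (rule hausdorff_measure_thick_fibres_eq_0[OF ab(1) _ C(1) _ _ _ _ \<open>s > 0\<close> k])
        (use \<beta> C(2) in \<open>auto simp: A_def\<close>)
  qed
  have "I_set E \<alpha> f \<subseteq> (\<Union>q\<in>J \<times> UNIV. Y (fst q) (snd q))"
  proof
    fix y assume "y \<in> I_set E \<alpha> f"
    then have "ereal \<alpha> \<le> hausdorff_dim (level_set E f y)" by (simp add: I_set_def)
    moreover have "ereal \<beta> < ereal \<alpha>" using \<beta>(2) by simp
    ultimately have "ereal \<beta> < hausdorff_dim (level_set E f y)" by (rule less_le_trans[rotated])
    then have pos: "hausdorff_measure \<beta> (level_set E f y) \<noteq> 0"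
      using \<beta>(1) by (intro hausdorff_measure_neq_0_if_less_dim) auto
    \<comment> \<open>\<open>S p\<close> holds the point of the level set that \<open>p\<close>
      isolates, if there is one. As \<open>p\<close> ranges over the countable set \<open>J\<close>,
      these null sets absorb all points outside \<open>A\<close>.\<close>
    define S where "S p = {x\<in>level_set E f y. level_set E f y \<inter> {fst p<..<snd p} = {x}}" for p
    have iso: "hausdorff_measure \<beta> (S p) = 0" for p
    proof -
      have "\<exists>x. S p \<subseteq> {x}"
      proof (cases "S p = {}")
        case False
        then obtain x where "x \<in> S p" by blast
        then have "S p \<subseteq> {x}" unfolding S_def by blast
        then show ?thesis by blast
      qed simp
      then obtain x where "S p \<subseteq> {x}" by blast
      then show ?thesis
        by (rule hausdorff_measure_eq_0_subset[OF hausdorff_measure_singleton, rotated])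
          (use \<beta>(1) in simp)
    qed
    let ?T = "\<lambda>p. A \<inter> {fst p..snd p} \<inter> f -` {y}"
    have cover: "level_set E f y \<subseteq> (\<Union>q\<in>J \<times> UNIV. if snd q then S (fst q) else ?T (fst q))"
    proof
      fix x assume x: "x \<in> level_set E f y"
      then have xE: "x \<in> E" "f x = y" by (auto simp: level_set_def)
      show "x \<in> (\<Union>q\<in>J \<times> UNIV. if snd q then S (fst q) else ?T (fst q))"
      proof (cases "x \<in> A")
        case True
        obtain p where p: "p \<in> J" "x \<in> {fst p<..<snd p}"
          using nearby[OF xE(1) E order_refl] by blast
        then have "x \<in> ?T p" using True xE(2) by auto
        then show ?thesis using p(1) by (intro UN_I[of "(p, False)"]) auto
      next
        case False
        then have "\<not> x islimpt level_set E f y" using xE by (simp add: A_def)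
        then obtain V where V: "x \<in> V" "open V" "\<And>z. \<lbrakk>z \<in> level_set E f y; z \<in> V\<rbrakk> \<Longrightarrow> z = x"
          unfolding islimpt_def by blast
        obtain p where p: "p \<in> J" "x \<in> {fst p<..<snd p}" "{fst p..snd p} \<subseteq> V \<inter> E"
          using nearby[of x "V \<inter> E"] V xE open_Int[OF V(2) E] by blast
        have "level_set E f y \<inter> {fst p<..<snd p} = {x}"
        proof
          show "level_set E f y \<inter> {fst p<..<snd p} \<subseteq> {x}"
          proof
            fix z assume z: "z \<in> level_set E f y \<inter> {fst p<..<snd p}"
            then have "z \<in> {fst p..snd p}" by auto
            then have "z \<in> V" using p(3) by blast
            then show "z \<in> {x}" using V(3) z by blast
          qed
        qed (use x p in auto)
        then have "x \<in> S p" using x by (simp add: S_def)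
        then show ?thesis using p(1) by (intro UN_I[of "(p, True)"]) auto
      qed
    qed
    have "\<exists>p\<in>J. hausdorff_measure \<beta> (?T p) \<noteq> 0"
    proof (rule ccontr)
      assume *: "\<not> ?thesis"
      have "hausdorff_measure \<beta> (\<Union>q\<in>J \<times> UNIV. if snd q then S (fst q) else ?T (fst q)) = 0"
        by (rule hausdorff_measure_UN_eq_0) (use iso J * in auto)
      from hausdorff_measure_eq_0_subset[OF this cover] show False using pos by contradiction
    qed
    then obtain p \<delta> where p: "p \<in> J" and \<delta>: "\<delta> > 0" "hausdorff_premeasure \<beta> \<delta> (?T p) \<noteq> 0"
      by (auto simp: hausdorff_measure_eq_0_iff)
    \<comment> \<open>One \<open>N\<close> has to serve both as lower bound for the premeasure and
      as scale. Shrinking the scale only increases the premeasure, so any large \<open>N\<close>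
      does.\<close>
    have lim: "(\<lambda>n. ennreal (1 / real (Suc n))) \<longlonglongrightarrow> 0"
      using tendsto_ennrealI[OF LIMSEQ_Suc[OF lim_1_over_n]] by simp
    have "eventually (\<lambda>n. ennreal (1 / real (Suc n)) < hausdorff_premeasure \<beta> \<delta> (?T p)) sequentially"
      using \<delta>(2) by (intro order_tendstoD(2)[OF lim]) (simp add: zero_less_iff_neq_zero)
    moreover have "eventually (\<lambda>n. 1 / real (Suc n) < \<delta>) sequentially"
      using \<delta>(1) by (intro order_tendstoD(2)[OF LIMSEQ_Suc[OF lim_1_over_n]])
    ultimately have "eventually (\<lambda>n. ennreal (1 / real (Suc n)) < hausdorff_premeasure \<beta> \<delta> (?T p) \<and>
        1 / real (Suc n) < \<delta>) sequentially"
      by (rule eventually_conj)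
    then obtain N where N: "ennreal (1 / real (Suc N)) < hausdorff_premeasure \<beta> \<delta> (?T p)"
        "1 / real (Suc N) < \<delta>"
      using eventually_happens'[OF sequentially_bot] by blast
    have "y \<in> Y p N"
      unfolding Y_def mem_Collect_eq
      using less_imp_le[OF N(1)] hausdorff_premeasure_antimono[OF less_imp_le[OF N(2)]]
      by (rule order_trans)
    then show "y \<in> (\<Union>q\<in>J \<times> UNIV. Y (fst q) (snd q))" using p by force
  qed
  moreover have "hausdorff_measure s (\<Union>q\<in>J \<times> UNIV. Y (fst q) (snd q)) = 0"
    using J Y0 by (intro hausdorff_measure_UN_eq_0) auto
  ultimately show "hausdorff_measure s (I_set E \<alpha> f) = 0"
    by (rule hausdorff_measure_eq_0_subset[rotated])
qed

section \<open>Constructing functions of class \<open>C\<^sup>k\<close>\<close>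

text \<open>Splitting off the first derivative instead of the last lets the closure lemmas run by
  induction on \<open>k\<close> with the functions generalised.\<close>

lemma C_k_Suc_iff:
  "f \<in> C_k (Suc k) UNIV \<longleftrightarrow> (\<forall>x. f field_differentiable at x) \<and> deriv f \<in> C_k k UNIV"
  by (simp add: C_k_def All_less_Suc2 funpow_Suc_right del: funpow.simps)

lemma C_k_SucI:
  assumes "\<And>x. (f has_real_derivative f' x) (at x)" "f' \<in> C_k k UNIV"
  shows "f \<in> C_k (Suc k) UNIV"
proof -
  have "deriv f = f'" using assms(1) by (auto intro: DERIV_imp_deriv)
  then show ?thesis using assms by (auto simp: C_k_Suc_iff field_differentiable_def)
qed

lemma C_k_SucD:
  assumes "f \<in> C_k (Suc k) UNIV"
  shows "(f has_real_derivative deriv f x) (at x)" "deriv f \<in> C_k k UNIV"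
  using assms by (auto simp: C_k_Suc_iff DERIV_deriv_iff_field_differentiable)

lemma C_k_0_iff: "f \<in> C_k 0 UNIV \<longleftrightarrow> continuous_on UNIV f"
  by (simp add: C_k_def)

lemma C_k_Suc_imp_C_k: "f \<in> C_k (Suc k) UNIV \<Longrightarrow> f \<in> C_k k UNIV"
proof (induction k arbitrary: f)
  case 0
  then show ?case
    using C_k_SucD(1)[OF 0] by (auto simp: C_k_0_iff intro: DERIV_isCont continuous_at_imp_continuous_on)
next
  case (Suc k)
  from C_k_SucD[OF Suc.prems] Suc.IH show ?case by (blast intro: C_k_SucI)
qed

lemma C_k_const: "(\<lambda>x. c) \<in> C_k k UNIV"
proof (induction k arbitrary: c)
  case (Suc k)
  have "((\<lambda>x. c) has_real_derivative 0) (at x)" for x by simp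
  then show ?case using Suc[of 0] by (rule C_k_SucI)
qed (simp add: C_k_0_iff)

lemma C_k_ident: "(\<lambda>x. x) \<in> C_k k UNIV"
proof (cases k)
  case (Suc j)
  have "((\<lambda>x. x) has_real_derivative 1) (at x)" for x by simp
  then show ?thesis unfolding Suc by (rule C_k_SucI) (rule C_k_const)
qed (simp add: C_k_0_iff)

lemma C_k_add:
  "\<lbrakk>f \<in> C_k k UNIV; g \<in> C_k k UNIV\<rbrakk> \<Longrightarrow> (\<lambda>x. f x + g x) \<in> C_k k UNIV"
proof (induction k arbitrary: f g)
  case (Suc k)
  note f = C_k_SucD[OF Suc.prems(1)] and g = C_k_SucD[OF Suc.prems(2)]
  show ?case by (rule C_k_SucI[OF DERIV_add[OF f(1) g(1)] Suc.IH[OF f(2) g(2)]])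
qed (simp add: C_k_0_iff continuous_on_add)

lemma C_k_mult:
  "\<lbrakk>f \<in> C_k k UNIV; g \<in> C_k k UNIV\<rbrakk> \<Longrightarrow> (\<lambda>x. f x * g x) \<in> C_k k UNIV"
proof (induction k arbitrary: f g)
  case (Suc k)
  note f = C_k_SucD[OF Suc.prems(1)] and g = C_k_SucD[OF Suc.prems(2)]
  note f' = C_k_Suc_imp_C_k[OF Suc.prems(1)] and g' = C_k_Suc_imp_C_k[OF Suc.prems(2)]
  show ?case
    by (rule C_k_SucI[OF DERIV_mult[OF f(1) g(1)]
          C_k_add[OF Suc.IH[OF f(2) g'] Suc.IH[OF g(2) f']]])
qed (simp add: C_k_0_iff continuous_on_mult)

lemma C_k_diff:
  assumes "f \<in> C_k k UNIV" "g \<in> C_k k UNIV"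
  shows "(\<lambda>x. f x - g x) \<in> C_k k UNIV"
  using C_k_add[OF assms(1) C_k_mult[OF C_k_const[of "-1"] assms(2)]] by simp

lemma C_k_sum:
  assumes "\<And>i. i \<in> I \<Longrightarrow> f i \<in> C_k k UNIV"
  shows "(\<lambda>x. \<Sum>i\<in>I. f i x) \<in> C_k k UNIV"
  using assms by (induction I rule: infinite_finite_induct) (auto intro: C_k_const C_k_add)

lemma C_k_inverse:
  "\<lbrakk>g \<in> C_k k UNIV; \<And>x. g x \<noteq> 0\<rbrakk> \<Longrightarrow> (\<lambda>x. inverse (g x)) \<in> C_k k UNIV"
proof (induction k arbitrary: g)
  case (Suc k)
  note g = C_k_SucD[OF Suc.prems(1)] and g' = C_k_Suc_imp_C_k[OF Suc.prems(1)]
  have "((\<lambda>x. inverse (g x)) has_real_derivative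
      (-1) * (deriv g x * (inverse (g x) * inverse (g x)))) (at x)" for x
    using DERIV_inverse_fun[OF g(1)[of x] Suc.prems(2)] by (simp add: field_simps)
  moreover have "(\<lambda>x. (-1) * (deriv g x * (inverse (g x) * inverse (g x)))) \<in> C_k k UNIV"
    by (intro C_k_mult C_k_const g(2) Suc.IH[OF g' Suc.prems(2)])
  ultimately show ?case by (rule C_k_SucI)
qed (simp add: C_k_0_iff continuous_on_inverse)

lemma C_k_compose:
  "\<lbrakk>f \<in> C_k k UNIV; g \<in> C_k k UNIV\<rbrakk> \<Longrightarrow> (\<lambda>x. f (g x)) \<in> C_k k UNIV"
proof (induction k arbitrary: f g)
  case 0
  then show ?case by (auto simp: C_k_0_iff intro: continuous_on_compose2)
next
  case (Suc k)
  note f = C_k_SucD[OF Suc.prems(1)] and g = C_k_SucD[OF Suc.prems(2)]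
  show ?case
    by (rule C_k_SucI[OF DERIV_chain2[OF f(1) g(1)]
          C_k_mult[OF Suc.IH[OF f(2) C_k_Suc_imp_C_k[OF Suc.prems(2)]] g(2)]])
qed

text \<open>Proved jointly because differentiation exchanges the two functions up to sign.\<close>

lemma C_k_sin_cos: "sin \<in> C_k k UNIV \<and> cos \<in> C_k k UNIV"
proof (induction k)
  case 0
  then show ?case by (simp add: C_k_0_iff continuous_on_sin continuous_on_cos)
next
  case (Suc k)
  have "(\<lambda>x. (-1) * sin x) \<in> C_k k UNIV" using Suc by (intro C_k_mult C_k_const) simp
  then have "(\<lambda>x. - sin x) \<in> C_k k UNIV" by simp
  then show ?case using Suc C_k_SucI[OF DERIV_sin] C_k_SucI[OF DERIV_cos] by blast
qed

section \<open>Step functions and periodic plateau functions\<close>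

text \<open>Only the origin is delicate: there the difference quotient is at most
  \<open>\<bar>h\<bar> ^ Suc n\<close>, which tends to 0 because the truncated power has exponent at
  least 2.\<close>

lemma DERIV_max_0_power:
  "((\<lambda>x::real. max 0 x ^ Suc (Suc n)) has_real_derivative real (Suc (Suc n)) * max 0 x ^ Suc n) (at x)"
proof -
  consider "x < 0" | "x = 0" | "x > 0" by linarith
  then show ?thesis
  proof cases
    case 1
    have "((\<lambda>x::real. 0) has_real_derivative 0) (at x)" by simp
    then have "((\<lambda>x::real. max 0 x ^ Suc (Suc n)) has_real_derivative 0) (at x)"
      by (rule has_field_derivative_transform_within_open[of _ _ _ "{..<0}"]) (use 1 in auto)
    then show ?thesis using 1 by simp
  next
    case 2
    have "((\<lambda>h::real. (max 0 (0 + h) ^ Suc (Suc n) - max 0 0 ^ Suc (Suc n)) / h) \<longlongrightarrow> 0) (at 0)"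
    proof (rule Lim_null_comparison)
      have "\<bar>max 0 h ^ Suc (Suc n) / h\<bar> \<le> \<bar>h\<bar> ^ Suc n" if "h \<noteq> 0" for h :: real
        using that by (cases "h < 0") (auto simp: max_def mult_nonpos_nonneg)
      then show "eventually (\<lambda>h::real. norm ((max 0 (0 + h) ^ Suc (Suc n) - max 0 0 ^ Suc (Suc n)) / h)
          \<le> \<bar>h\<bar> ^ Suc n) (at 0)"
        by (auto simp: eventually_at_filter)
      show "((\<lambda>h::real. \<bar>h\<bar> ^ Suc n) \<longlongrightarrow> 0) (at 0)"
        by (auto intro!: tendsto_eq_intros)
    qed
    then show ?thesis using 2 by (simp add: DERIV_def)
  next
    case 3
    have "((\<lambda>x::real. x ^ Suc (Suc n)) has_real_derivative real (Suc (Suc n)) * x ^ Suc n) (at x)"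
      using DERIV_pow[of "Suc (Suc n)" x] by simp
    then have "((\<lambda>x::real. max 0 x ^ Suc (Suc n)) has_real_derivative
        real (Suc (Suc n)) * x ^ Suc n) (at x)"
      by (rule has_field_derivative_transform_within_open[of _ _ _ "{0<..}"]) (use 3 in auto)
    then show ?thesis using 3 by simp
  qed
qed

lemma C_k_max_0_power: "(\<lambda>x::real. max 0 x ^ Suc k) \<in> C_k k UNIV"
proof (induction k)
  case 0
  show ?case by (simp add: C_k_0_iff) (intro continuous_intros)
next
  case (Suc k)
  show ?case
    by (rule C_k_SucI[OF DERIV_max_0_power C_k_mult[OF C_k_const Suc]])
qed

text \<open>The quotient of \<open>A x\<close> by \<open>A x + A (1 - x)\<close> works for the
  truncated power \<open>A\<close>: as \<open>x\<close> and \<open>1 - x\<close> are never both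
  nonpositive, the denominator is positive.\<close>

lemma ex_C_k_step: "\<exists>f\<in>C_k k UNIV. (\<forall>x\<le>0. f x = 0) \<and> (\<forall>x\<ge>1. f x = (1::real))"
proof -
  define A where "A x = max 0 x ^ Suc k" for x :: real
  have A: "A \<in> C_k k UNIV" unfolding A_def by (rule C_k_max_0_power)
  have A': "(\<lambda>x. A (1 - x)) \<in> C_k k UNIV"
    by (intro C_k_compose[OF A] C_k_diff C_k_const C_k_ident)
  have pos: "A x + A (1 - x) > 0" for x
  proof (cases "x > 0")
    case True
    then have "A x > 0" "A (1 - x) \<ge> 0" by (simp_all add: A_def)
    then show ?thesis by simp
  next
    case False
    then have "A x \<ge> 0" "A (1 - x) > 0" by (simp_all add: A_def)
    then show ?thesis by simp
  qed
  have "(\<lambda>x. A x * inverse (A x + A (1 - x))) \<in> C_k k UNIV"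
    using pos by (intro C_k_mult[OF A] C_k_inverse C_k_add A A') (metis less_irrefl)
  moreover have "A x * inverse (A x + A (1 - x)) = 0" if "x \<le> 0" for x
    using that by (simp add: A_def max_def)
  moreover have "A x * inverse (A x + A (1 - x)) = 1" if "x \<ge> 1" for x
  proof -
    have "A (1 - x) = 0" using that by (simp add: A_def max_def)
    then show ?thesis using pos[of x] by simp
  qed
  ultimately show ?thesis by (intro bexI[of _ "\<lambda>x. A x * inverse (A x + A (1 - x))"]) auto
qed

text \<open>A cosine of period \<open>p\<close>, centred on the plateau \<open>[0, 1 / 2]\<close>,
  is at least \<open>b\<close> on the plateaus of multiples of \<open>p\<close> and at most
  \<open>a < b\<close> on the others. Rescaling \<open>a\<close>, \<open>b\<close> to 0, 1 and
  applying the step \<open>\<sigma>\<close> flattens it to the values 1 and 0.\<close>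

lemma ex_C_k_residue_indicator:
  assumes p: "p \<ge> (2::nat)"
  shows "\<exists>\<phi>\<in>C_k k UNIV. (\<forall>t. \<phi> (t + real p) = \<phi> t) \<and>
    (\<forall>z t. real_of_int z \<le> t \<longrightarrow> t \<le> real_of_int z + 1 / 2 \<longrightarrow>
      \<phi> t = (if int p dvd z then 1 else 0))"
proof -
  obtain \<sigma> where \<sigma>: "\<sigma> \<in> C_k k UNIV" "\<And>x. x \<le> 0 \<Longrightarrow> \<sigma> x = 0" "\<And>x. x \<ge> 1 \<Longrightarrow> \<sigma> x = (1::real)"
    using ex_C_k_step by blast
  \<comment> \<open>The shift 1/4 is the midpoint of the plateau. Its points are within 1/4 of the
    midpoint, and points on plateaus of other residues are at least 3/4 away modulo
    \<open>p\<close>; these distances give the angles in \<open>b\<close> and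
    \<open>a\<close>.\<close>
  define \<theta> where "\<theta> t = 2 * pi / real p * (t - 1 / 4)" for t
  define a where "a = cos (3 * pi / (2 * real p))"
  define b where "b = cos (pi / (2 * real p))"
  define \<phi> where "\<phi> t = \<sigma> (inverse (b - a) * (cos (\<theta> t) - a))" for t
  have p0: "real p > 0" and p2: "real p \<ge> 2" using p by auto
  have small: "3 * pi / (2 * real p) \<le> pi"
    using p2 by (simp add: field_simps)
  have "a < b" unfolding a_def b_def
    by (rule cos_monotone_0_pi) (use small p0 in \<open>auto simp: field_simps\<close>)
  have \<phi>: "\<phi> \<in> C_k k UNIV" unfolding \<phi>_def \<theta>_def
    by (intro C_k_compose[OF \<sigma>(1)] C_k_mult C_k_diff C_k_const C_k_ident
        C_k_compose[OF conjunct2[OF C_k_sin_cos]])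
  have per: "\<theta> (t + real p * of_int l) = \<theta> t + 2 * pi * of_int l" for t l
    using p0 by (simp add: \<theta>_def field_simps)
  have cos_per: "cos (\<theta> (t + real p * of_int l)) = cos (\<theta> t)" for t l
    unfolding per cos_add cos_int_2pin sin_int_2pin by simp
  have val: "\<phi> t = (if int p dvd z then 1 else 0)"
    if t: "real_of_int z \<le> t" "t \<le> real_of_int z + 1 / 2" for z t
  proof -
    define r where "r = z mod int p"
    define u where "u = t - of_int z"
    have r: "0 \<le> r" "r \<le> int p - 1" using p by (auto simp: r_def)
    then have r': "real_of_int r \<le> real p - 1" by linarith
    have u: "0 \<le> u" "u \<le> 1 / 2" using t by (auto simp: u_def)
    have "z = r + int p * (z div int p)" by (simp add: r_def)
    then have "real_of_int z = real_of_int r + real p * of_int (z div int p)"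
      by (metis of_int_add of_int_mult of_int_of_nat_eq)
    then have "t = (r + u) + real p * of_int (z div int p)" by (simp add: u_def)
    then have ct: "cos (\<theta> t) = cos (\<theta> (r + u))" using cos_per by metis
    show ?thesis
    proof (cases "int p dvd z")
      case True
      then have "r = 0" by (simp add: r_def)
      have "\<bar>\<theta> (r + u)\<bar> \<le> pi / (2 * real p)"
      proof -
        have "\<bar>\<theta> (r + u)\<bar> = 2 * pi / real p * \<bar>u - 1 / 4\<bar>"
          using p0 \<open>r = 0\<close> by (simp add: \<theta>_def abs_mult)
        also have "\<dots> \<le> 2 * pi / real p * (1 / 4)"
        proof (rule mult_left_mono)
          show "\<bar>u - 1 / 4\<bar> \<le> 1 / 4" using u unfolding abs_le_iff by linarith
        qed (use p0 in simp)
        finally show ?thesis by simp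
      qed
      moreover have "pi / (2 * real p) \<le> pi" using p2 by (simp add: field_simps)
      ultimately have "b \<le> cos \<bar>\<theta> (r + u)\<bar>" unfolding b_def
        by (intro cos_monotone_0_pi_le) auto
      then have "b \<le> cos (\<theta> t)" using ct by simp
      then have "inverse (b - a) * (cos (\<theta> t) - a) \<ge> 1" using \<open>a < b\<close> by (simp add: field_simps)
      then show ?thesis using True by (simp add: \<phi>_def \<sigma>(3))
    next
      case False
      then have "r \<ge> 1" using r by (simp add: r_def dvd_eq_mod_eq_0)
      then have r1: "real_of_int r \<ge> 1" by simp
      have lo: "3 * pi / (2 * real p) \<le> \<theta> (r + u)"
      proof -
        have "2 * pi / real p * (3 / 4) \<le> \<theta> (r + u)"
          unfolding \<theta>_def using r1 u p0 by (intro mult_left_mono) auto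
        then show ?thesis by simp
      qed
      have hi: "\<theta> (r + u) \<le> 2 * pi - 3 * pi / (2 * real p)"
      proof -
        have "\<theta> (r + u) \<le> 2 * pi / real p * (real p - 3 / 4)"
          unfolding \<theta>_def using r' u p0 by (intro mult_left_mono) auto
        also have "\<dots> = 2 * pi - 3 * pi / (2 * real p)" using p0 by (simp add: field_simps)
        finally show ?thesis .
      qed
      have "cos (\<theta> (r + u)) \<le> a"
      proof (cases "\<theta> (r + u) \<le> pi")
        case True
        then show ?thesis unfolding a_def using lo p0 by (intro cos_monotone_0_pi_le) auto
      next
        case False
        have "cos (2 * pi - \<theta> (r + u)) \<le> a"
          unfolding a_def using False hi p0 by (intro cos_monotone_0_pi_le) auto
        then show ?thesis by (simp add: cos_diff)
      qed
      then have "inverse (b - a) * (cos (\<theta> t) - a) \<le> 0"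
        using \<open>a < b\<close> ct by (intro mult_nonneg_nonpos) auto
      then show ?thesis using False by (simp add: \<phi>_def \<sigma>(2))
    qed
  qed
  have "\<phi> (t + real p) = \<phi> t" for t
    using cos_per[of t 1] by (simp add: \<phi>_def)
  then show ?thesis using \<phi> val by (intro bexI[of _ \<phi>]) auto
qed

text \<open>Superpose the indicators shifted by \<open>i\<close> with weights \<open>i\<close>: on
  the plateau of \<open>z\<close> exactly the one with \<open>i = z mod p\<close> equals 1.\<close>

lemma ex_C_k_residue:
  assumes p: "p \<ge> (2::nat)"
  shows "\<exists>h\<in>C_k k UNIV. (\<forall>t. h (t + real p) = h t) \<and>
    (\<forall>z t. real_of_int z \<le> t \<longrightarrow> t \<le> real_of_int z + 1 / 2 \<longrightarrow> h t = real_of_int (z mod int p))"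
proof -
  obtain \<phi> where \<phi>: "\<phi> \<in> C_k k UNIV" "\<And>t. \<phi> (t + real p) = \<phi> t"
    "\<And>z t. \<lbrakk>real_of_int z \<le> t; t \<le> real_of_int z + 1 / 2\<rbrakk> \<Longrightarrow> \<phi> t = (if int p dvd z then 1 else 0)"
    using ex_C_k_residue_indicator[OF p, of k] by auto
  define h where "h t = (\<Sum>i<p. real i * \<phi> (t - real i))" for t
  have "h \<in> C_k k UNIV" unfolding h_def
    by (intro C_k_sum C_k_mult C_k_compose[OF \<phi>(1)] C_k_diff C_k_const C_k_ident)
  moreover have "h (t + real p) = h t" for t
    unfolding h_def
  proof (rule sum.cong[OF refl])
    fix i
    have "t + real p - real i = (t - real i) + real p" by simp
    then show "real i * \<phi> (t + real p - real i) = real i * \<phi> (t - real i)"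
      using \<phi>(2) by metis
  qed
  moreover have "h t = real_of_int (z mod int p)"
    if "real_of_int z \<le> t" "t \<le> real_of_int z + 1 / 2" for z t
  proof -
    have *: "int p dvd z - int i \<longleftrightarrow> i = nat (z mod int p)" if "i < p" for i
    proof -
      have "int p dvd z - int i \<longleftrightarrow> z mod int p = int i mod int p"
        by (simp add: mod_eq_dvd_iff)
      also have "int i mod int p = int i" using that by simp
      finally show ?thesis using p by (auto simp: nat_eq_iff2)
    qed
    have "h t = (\<Sum>i<p. if i = nat (z mod int p) then real i else 0)"
      unfolding h_def
    proof (rule sum.cong[OF refl])
      fix i assume i: "i \<in> {..<p}"
      have "\<phi> (t - real i) = (if int p dvd z - int i then 1 else 0)"
        using that by (intro \<phi>(3)) auto
      then show "real i * \<phi> (t - real i) = (if i = nat (z mod int p) then real i else 0)"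
        using *[of i] i by simp
    qed
    also have "\<dots> = real (nat (z mod int p))"
      using p by (simp add: sum.delta nat_less_iff)
    finally show ?thesis using p by simp
  qed
  ultimately show ?thesis by (intro bexI[of _ h]) auto
qed

section \<open>Bounded derivatives and lacunary series\<close>

lemma deriv_shift: "deriv (\<lambda>x. f (x + c)) = (\<lambda>x. deriv f (x + c))"
  by (rule ext) (simp add: deriv_def DERIV_shift)

text \<open>Derivatives inherit the period, so a bound on the compact interval \<open>[0, T]\<close>
  is global.\<close>

lemma C_k_periodic_derivs_bounded:
  assumes f: "f \<in> C_k k UNIV" and T: "T > 0" and per: "\<And>t. f (t + T) = f t" and j: "j \<le> k"
  shows "\<exists>M. \<forall>t. \<bar>(deriv ^^ j) f t\<bar> \<le> M"
proof -
  let ?g = "(deriv ^^ j) f"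
  have "(deriv ^^ j) f (t + T) = (deriv ^^ j) f t" for j t
  proof (induction j arbitrary: t)
    case (Suc j)
    have "(\<lambda>t. (deriv ^^ j) f (t + T)) = (deriv ^^ j) f" using Suc by auto
    from arg_cong[OF this, of deriv] show ?case by (simp add: deriv_shift fun_eq_iff)
  qed (simp add: per)
  then interpret periodic_fun_simple ?g T by unfold_locales
  have "continuous_on UNIV ?g"
  proof (cases "j = k")
    case False
    then show ?thesis using f j
      by (auto simp: C_k_def intro!: continuous_at_imp_continuous_on field_differentiable_imp_continuous_at)
  qed (use f in \<open>simp add: C_k_def\<close>)
  then have "bounded (?g ` {0..T})"
    by (intro compact_imp_bounded compact_continuous_image) (auto intro: continuous_on_subset)
  then have "\<exists>M. \<forall>t\<in>{0..T}. \<bar>?g t\<bar> \<le> M" by (simp add: bounded_iff)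
  then obtain M where M: "\<And>t. t \<in> {0..T} \<Longrightarrow> \<bar>?g t\<bar> \<le> M" by blast
  have "\<bar>?g t\<bar> \<le> M" for t
  proof -
    have "t - of_int \<lfloor>t / T\<rfloor> * T = frac (t / T) * T"
      using T by (simp add: frac_def field_simps)
    moreover have "0 \<le> frac (t / T) * T" "frac (t / T) * T \<le> T"
      using T frac_ge_0[of "t / T"] frac_lt_1[of "t / T"] by (auto simp: mult_le_cancel_right2)
    ultimately have "t - of_int \<lfloor>t / T\<rfloor> * T \<in> {0..T}" by simp
    from M[OF this] show ?thesis by (simp add: minus_of_int)
  qed
  then show ?thesis by blast
qed

text \<open>Differentiating term by term gives a series of the same shape with
  \<open>deriv h\<close> for \<open>h\<close> and \<open>\<rho> * R\<close> for
  \<open>\<rho>\<close>, and \<open>\<rho> * R ^ Suc k = (\<rho> * R) * R ^ k\<close>. Hence the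
  induction varies \<open>h\<close> and \<open>\<rho>\<close>; uniform convergence comes from
  comparison with a geometric series.\<close>

lemma C_k_lacunary_series:
  fixes R \<rho> :: real
  assumes "R \<ge> 1"
  shows "\<lbrakk>h \<in> C_k k UNIV; \<And>j. j \<le> k \<Longrightarrow> \<exists>M. \<forall>t. \<bar>(deriv ^^ j) h t\<bar> \<le> M;
    0 \<le> \<rho>; \<rho> * R ^ k < 1\<rbrakk> \<Longrightarrow> (\<lambda>x. \<Sum>n. \<rho> ^ n * h (R ^ n * x)) \<in> C_k k UNIV"
proof (induction k arbitrary: h \<rho>)
  case 0
  obtain M where M: "\<And>t. \<bar>h t\<bar> \<le> M" using 0(2)[of 0] by auto
  have "uniform_limit UNIV (\<lambda>n x. \<Sum>i<n. \<rho> ^ i * h (R ^ i * x)) (\<lambda>x. \<Sum>n. \<rho> ^ n * h (R ^ n * x)) sequentially"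
    using 0 M by (intro Weierstrass_m_test[where M = "\<lambda>n. \<rho> ^ n * M"])
      (auto simp: abs_mult power_abs intro!: mult_left_mono summable_mult2 summable_geometric)
  then show ?case unfolding C_k_0_iff
    by (rule uniform_limit_theorem[rotated])
      (use 0 in \<open>auto simp: C_k_0_iff intro!: always_eventually continuous_intros
        intro: continuous_on_compose2[of UNIV h]\<close>)
next
  case (Suc k)
  note h = C_k_SucD[OF Suc.prems(1)]
  obtain M0 where M0: "\<And>t. \<bar>h t\<bar> \<le> M0" using Suc.prems(2)[of 0] by auto
  obtain M where M: "\<And>t. \<bar>deriv h t\<bar> \<le> M" using Suc.prems(2)[of 1] by auto
  have Rk: "1 \<le> R ^ k" using assms by simp
  have \<rho>R: "0 \<le> \<rho> * R" "\<rho> * R * R ^ k < 1" using Suc.prems assms by (auto simp: mult.assoc)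
  have "\<rho> * R \<le> \<rho> * R * R ^ k" using mult_left_mono[OF Rk \<rho>R(1)] by simp
  then have \<rho>R1: "\<rho> * R < 1" using \<rho>R(2) by linarith
  have "\<rho> \<le> \<rho> * R" using mult_left_mono[OF assms \<open>0 \<le> \<rho>\<close>] by simp
  then have \<rho>1: "\<rho> < 1" using \<rho>R1 by linarith
  have D: "((\<lambda>x. \<rho> ^ n * h (R ^ n * x)) has_real_derivative (\<rho> * R) ^ n * deriv h (R ^ n * x)) (at x)" for n x
  proof -
    have "((\<lambda>x. h (R ^ n * x)) has_real_derivative deriv h (R ^ n * x) * R ^ n) (at x)"
      by (rule DERIV_chain2[OF h(1)]) (auto intro!: derivative_eq_intros)
    from DERIV_cmult[OF this, of "\<rho> ^ n"] show ?thesis by (simp add: power_mult_distrib mult_ac)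
  qed
  have unif: "uniformly_convergent_on UNIV (\<lambda>n x. \<Sum>i<n. (\<rho> * R) ^ i * deriv h (R ^ i * x))"
    using \<rho>R \<rho>R1 M assms Suc.prems(3) by (intro Weierstrass_m_test'[where M = "\<lambda>n. (\<rho> * R) ^ n * M"])
      (auto simp: abs_mult power_abs intro!: mult_mono summable_mult2 summable_geometric)
  have sum0: "summable (\<lambda>n. \<rho> ^ n * h (R ^ n * 0))"
    using \<open>0 \<le> \<rho>\<close> \<rho>1 by (simp add: summable_mult2 summable_geometric)
  have "((\<lambda>x. \<Sum>n. \<rho> ^ n * h (R ^ n * x)) has_real_derivative
      (\<Sum>n. (\<rho> * R) ^ n * deriv h (R ^ n * x))) (at x)" for x
    by (rule has_field_derivative_series'(2)[where S = UNIV and ?x0.0 = 0])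
      (use D unif sum0 in auto)
  moreover have "(\<lambda>x. \<Sum>n. (\<rho> * R) ^ n * deriv h (R ^ n * x)) \<in> C_k k UNIV"
  proof (rule Suc.IH[OF h(2) _ \<rho>R])
    show "\<exists>M. \<forall>t. \<bar>(deriv ^^ j) (deriv h) t\<bar> \<le> M" if "j \<le> k" for j
      using Suc.prems(2)[of "Suc j"] that by (simp add: funpow_Suc_right del: funpow.simps)
  qed
  ultimately show ?case by (rule C_k_SucI)
qed

section \<open>Digit expansions and the lower bound\<close>

text \<open>Index 0 is the first place after the point. Where two expansions exist, the floor
  selects the terminating one.\<close>

definition digit :: "nat \<Rightarrow> real \<Rightarrow> nat \<Rightarrow> nat" where
  "digit b y n = nat (\<lfloor>real b ^ Suc n * y\<rfloor> mod int b)"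

lemma digit_less: "b > 0 \<Longrightarrow> digit b y n < b"
  by (simp add: digit_def nat_less_iff)

text \<open>Each further factor \<open>b\<close> multiplies the floor by \<open>b\<close> and adds
  the next digit, so equal digits preserve equal floors, starting from floor 0 on
  \<open>{0..<1}\<close>.\<close>

lemma floor_eq_if_digits_eq:
  assumes b: "b > 0" and yz: "y \<in> {0..<1}" "z \<in> {0..<1}"
    and eq: "\<And>l. l < n \<Longrightarrow> digit b y l = digit b z l"
  shows "\<lfloor>real b ^ n * y\<rfloor> = \<lfloor>real b ^ n * z\<rfloor>"
  using eq
proof (induction n)
  case 0
  have "\<lfloor>y\<rfloor> = 0" "\<lfloor>z\<rfloor> = 0" using yz by (auto simp: floor_eq_iff)
  then show ?case by simp
next
  case (Suc n)
  have split: "\<lfloor>real b ^ Suc n * w\<rfloor> = int b * \<lfloor>real b ^ n * w\<rfloor> + int (digit b w n)" for w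
  proof -
    have "real b ^ Suc n * w / real_of_int (int b) = real b ^ n * w" using b by simp
    then have "\<lfloor>real b ^ Suc n * w\<rfloor> div int b = \<lfloor>real b ^ n * w\<rfloor>"
      using floor_divide_real_eq_div[of "int b" "real b ^ Suc n * w"] by simp
    moreover have "int (digit b w n) = \<lfloor>real b ^ Suc n * w\<rfloor> mod int b"
      using b by (simp add: digit_def)
    ultimately show ?thesis by (metis mult_div_mod_eq)
  qed
  show ?case unfolding split using Suc.IH Suc.prems by simp
qed

text \<open>Agreement in the first \<open>n\<close> digits means equal floors at level
  \<open>n\<close>, hence distance at most \<open>(1 / b) ^ n\<close>. Distinct points therefore
  cannot agree in all digits, and \<open>n\<close> is the least index of disagreement.\<close>

lemma ex_first_digit_neq:
  assumes b: "b \<ge> 2" and yz: "y \<in> {0..<1}" "z \<in> {0..<1}" "y \<noteq> z"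
  obtains n where "\<And>l. l < n \<Longrightarrow> digit b y l = digit b z l" "digit b y n \<noteq> digit b z n"
    "\<bar>y - z\<bar> \<le> (1 / real b) ^ n"
proof -
  have close: "\<bar>y - z\<bar> \<le> (1 / real b) ^ n" if "\<And>l. l < n \<Longrightarrow> digit b y l = digit b z l" for n
  proof -
    have "\<lfloor>real b ^ n * y\<rfloor> = \<lfloor>real b ^ n * z\<rfloor>"
      using b yz that by (intro floor_eq_if_digits_eq) auto
    then have "\<bar>real b ^ n * y - real b ^ n * z\<bar> \<le> 1" by linarith
    then have "real b ^ n * \<bar>y - z\<bar> \<le> 1" using b by (simp add: abs_mult flip: right_diff_distrib)
    then show ?thesis using b by (simp add: field_simps)
  qed
  have "\<exists>n. digit b y n \<noteq> digit b z n"
  proof (rule ccontr)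
    assume "\<not> ?thesis"
    then have *: "\<bar>y - z\<bar> \<le> (1 / real b) ^ n" for n using close by blast
    obtain n where "(1 / real b) ^ n < \<bar>y - z\<bar>"
      using real_arch_pow_inv[of "\<bar>y - z\<bar>" "1 / real b"] b yz(3) by auto
    then show False using *[of n] by simp
  qed
  then have L: "digit b y (LEAST n. digit b y n \<noteq> digit b z n) \<noteq>
      digit b z (LEAST n. digit b y n \<noteq> digit b z n)" (is "digit b y ?n \<noteq> _")
    by (rule LeastI_ex)
  have less: "digit b y l = digit b z l" if "l < ?n" for l
    using not_less_Least[OF that] by simp
  show thesis using that[OF less L close[OF less]] by blast
qed

section \<open>Series with bounded integer digits\<close>

lemma expansion_summable:
  fixes q :: real
  assumes "0 < q" "q < 1" "\<And>i. d i < (D::nat)"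
  shows "summable (\<lambda>i. real (d i) * q ^ i)"
proof (rule summable_comparison_test')
  show "summable (\<lambda>i. real D * q ^ i)" using assms by (intro summable_mult summable_geometric) simp
  show "norm (real (d i) * q ^ i) \<le> real D * q ^ i" if "i \<ge> 0" for i
    using assms less_imp_le[OF assms(3)] by (simp add: abs_mult mult_right_mono)
qed

lemma expansion_bounds:
  fixes q :: real
  assumes q: "0 < q" "q < 1" and d: "\<And>i. d i < (D::nat)"
  shows "0 \<le> (\<Sum>i. real (d i) * q ^ i)" "(\<Sum>i. real (d i) * q ^ i) \<le> real D / (1 - q)"
proof -
  show "0 \<le> (\<Sum>i. real (d i) * q ^ i)"
    using q by (intro suminf_nonneg expansion_summable[OF q d]) auto
  have "(\<Sum>i. real (d i) * q ^ i) \<le> (\<Sum>i. real D * q ^ i)"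
    using q less_imp_le[OF d]
    by (intro suminf_le expansion_summable[OF q d] summable_mult summable_geometric)
      (auto intro: mult_right_mono)
  also have "\<dots> = real D / (1 - q)"
    using q suminf_mult[OF summable_geometric[of q], of "real D"] by (simp add: suminf_geometric)
  finally show "(\<Sum>i. real (d i) * q ^ i) \<le> real D / (1 - q)" .
qed

text \<open>The first difference contributes at least \<open>q ^ n\<close>. Since
  \<open>D * q \<le> 1 / 4\<close> and \<open>q \<le> 1 / 4\<close>, the tail is at most a third of
  \<open>q ^ n\<close>.\<close>

lemma expansion_separated:
  fixes q :: real
  assumes q: "0 < q" "4 * real D * q \<le> 1" and d: "\<And>i. d i < D" "\<And>i. d' i < D"
    and eq: "\<And>l. l < n \<Longrightarrow> d l = d' l" and neq: "d n \<noteq> d' n"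
  shows "q ^ n / 2 \<le> \<bar>(\<Sum>i. real (d i) * q ^ i) - (\<Sum>i. real (d' i) * q ^ i)\<bar>"
proof -
  have D: "real D \<ge> 1" using d(1)[of 0] by linarith
  have q4: "q \<le> 1 / 4"
  proof -
    have "4 * q * 1 \<le> 4 * q * real D" using D q by (intro mult_left_mono) auto
    then show ?thesis using q(2) by (simp add: mult_ac)
  qed
  then have q1: "q < 1" by simp
  define e where "e i = (real (d i) - real (d' i)) * q ^ i" for i
  note sd = expansion_summable[OF q(1) q1 d(1)] and sd' = expansion_summable[OF q(1) q1 d(2)]
  have se: "summable e"
    unfolding e_def left_diff_distrib by (rule summable_diff[OF sd sd'])
  have "(\<Sum>i. real (d i) * q ^ i) - (\<Sum>i. real (d' i) * q ^ i) = suminf e"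
    unfolding e_def left_diff_distrib by (rule suminf_diff[OF sd sd'])
  also have "\<dots> = (\<Sum>i. e (i + Suc n)) + (\<Sum>i<Suc n. e i)"
    by (rule suminf_split_initial_segment[OF se])
  also have "(\<Sum>i<Suc n. e i) = e n" using eq by (simp add: e_def)
  finally have *: "(\<Sum>i. real (d i) * q ^ i) - (\<Sum>i. real (d' i) * q ^ i) = (\<Sum>i. e (i + Suc n)) + e n" .
  have "\<bar>real (d n) - real (d' n)\<bar> \<ge> 1" using neq by linarith
  then have en: "q ^ n \<le> \<bar>e n\<bar>"
    using q(1) by (simp add: e_def abs_mult)
  have "\<bar>\<Sum>i. e (i + Suc n)\<bar> \<le> (\<Sum>i. real D * q ^ Suc n * q ^ i)"
  proof (rule norm_suminf_le[where 'a = real, unfolded real_norm_def])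
    show "summable (\<lambda>i. real D * q ^ Suc n * q ^ i)"
      using q q1 by (intro summable_mult summable_geometric) auto
    fix i
    have "\<bar>real (d (i + Suc n)) - real (d' (i + Suc n))\<bar> \<le> real D"
      using d(1)[of "i + Suc n"] d(2)[of "i + Suc n"] by linarith
    then show "\<bar>e (i + Suc n)\<bar> \<le> real D * q ^ Suc n * q ^ i"
      using q(1) by (simp add: e_def abs_mult power_add mult_ac mult_right_mono mult_left_mono)
  qed
  also have "\<dots> = real D * q ^ Suc n * (1 / (1 - q))"
    using q q1 suminf_mult[OF summable_geometric[of q], of "real D * q ^ Suc n"]
    by (simp add: suminf_geometric)
  also have "\<dots> = q ^ n * (real D * q / (1 - q))" by simp
  also have "\<dots> \<le> q ^ n * (1 / 2)"
    using q q4 by (intro mult_left_mono) (auto simp: field_simps)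
  finally show ?thesis unfolding * using en by linarith
qed

text \<open>Serves both for the fibres and for the set of values: base \<open>b\<close> digits of
  \<open>y\<close> are reread as digits in powers of \<open>q\<close>. If \<open>n\<close> is the
  first index of disagreement, then
  \<open>\<bar>y - z\<bar> \<le> (1 / b) ^ n \<le> (q ^ n) powr s\<close>, and \<open>q ^ n\<close>
  is at most \<open>2 / c\<close> times the distance of the images. The factor \<open>c\<close>
  allows for rescaling into \<open>E\<close>.\<close>

lemma hausdorff_dim_ge_if_expansion:
  fixes X :: "real \<Rightarrow> 'a::metric_space"
  assumes b: "b \<ge> 2" and q: "0 < q" "4 * real D * q \<le> 1" and s: "s > 0" "1 / real b \<le> q powr s"
    and d: "\<And>y i. d y i < D"
    and d_digit: "\<And>y z i. d y i = d z i \<longleftrightarrow> digit b y i = digit b z i"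
    and c: "c > 0" and X: "\<And>y z. dist (X y) (X z) =
      c * \<bar>(\<Sum>i. real (d y i) * q ^ i) - (\<Sum>i. real (d z i) * q ^ i)\<bar>"
    and F: "X ` {0..<1} \<subseteq> F"
  shows "ereal s \<le> hausdorff_dim F"
proof (rule hausdorff_dim_ge_if_inverse_hoelder[OF s(1) F])
  fix y z :: real assume yz: "y \<in> {0..<1}" "z \<in> {0..<1}"
  show "\<bar>y - z\<bar> \<le> (2 / c) powr s * dist (X y) (X z) powr s"
  proof (cases "y = z")
    case False
    obtain n where n: "\<And>l. l < n \<Longrightarrow> digit b y l = digit b z l" "digit b y n \<noteq> digit b z n"
      "\<bar>y - z\<bar> \<le> (1 / real b) ^ n"
      using ex_first_digit_neq[OF b yz False] by blast
    have "q ^ n / 2 \<le> \<bar>(\<Sum>i. real (d y i) * q ^ i) - (\<Sum>i. real (d z i) * q ^ i)\<bar>"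
      by (rule expansion_separated[OF q d d]) (use n d_digit in auto)
    then have sep: "q ^ n \<le> 2 / c * dist (X y) (X z)" using c by (simp add: X)
    note n(3)
    also have "(1 / real b) ^ n \<le> (q powr s) ^ n" using s(2) by (intro power_mono) auto
    also have "\<dots> = (q ^ n) powr s" using q(1) by (simp add: powr_powr powr_realpow[symmetric] mult.commute)
    also have "\<dots> \<le> (2 / c * dist (X y) (X z)) powr s"
      using sep s(1) q(1) by (intro powr_mono2) auto
    also have "\<dots> = (2 / c) powr s * dist (X y) (X z) powr s"
      using c by (intro powr_mult)
    finally show ?thesis .
  qed simp
qed

text \<open>Multiplying by \<open>R ^ n\<close> moves the digits up to index \<open>n\<close> into
  an integer \<open>z\<close>. As the digits are below a quarter of the base, the rest is a tail
  \<open>\<tau>\<close> in \<open>[0, 1 / 2]\<close>, so \<open>h\<close> is evaluated on the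
  plateau of \<open>z\<close>. Modulo \<open>p\<close> only the last digit of \<open>z\<close>
  survives, because \<open>p\<close> divides \<open>R\<close>.\<close>

lemma residue_function_at_expansion:
  assumes R: "R = 4 * D" and D: "D > 0" and p: "p > 0" "p dvd R" and d: "\<And>i. d i < D"
    and h: "\<And>z t. \<lbrakk>real_of_int z \<le> t; t \<le> real_of_int z + 1 / 2\<rbrakk> \<Longrightarrow> h t = real_of_int (z mod int p)"
  shows "h (real R ^ n * (\<Sum>i. real (d i) * (1 / real R) ^ i)) = real (d n mod p)"
proof -
  let ?q = "1 / real R"
  have R0: "real R \<ge> 4" using R D by simp
  have q: "0 < ?q" "?q < 1" using R0 by auto
  have sd: "summable (\<lambda>i. real (d i) * ?q ^ i)" by (rule expansion_summable[OF q d])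
  define z where "z = (\<Sum>i<Suc n. d i * R ^ (n - i))"
  define \<tau> where "\<tau> = ?q * (\<Sum>i. real (d (i + Suc n)) * ?q ^ i)"
  have tail: "(\<Sum>i. real (d (i + Suc n)) * ?q ^ (i + Suc n)) = ?q ^ n * \<tau>"
  proof -
    have "summable (\<lambda>i. real (d (i + Suc n)) * ?q ^ i)" by (rule expansion_summable[OF q d])
    from suminf_mult[OF this, of "?q ^ Suc n"] show ?thesis
      by (simp add: \<tau>_def power_add mult_ac)
  qed
  have "real R ^ n * (\<Sum>i. real (d i) * ?q ^ i) =
      real R ^ n * (?q ^ n * \<tau> + (\<Sum>i<Suc n. real (d i) * ?q ^ i))"
    using suminf_split_initial_segment[OF sd, of "Suc n"] tail by simp
  also have "\<dots> = \<tau> + (\<Sum>i<Suc n. real (d i) * (real R ^ n * ?q ^ i))"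
    using R0 by (simp add: distrib_left sum_distrib_left power_divide mult_ac del: sum.lessThan_Suc)
  also have "(\<Sum>i<Suc n. real (d i) * (real R ^ n * ?q ^ i)) = real z"
    unfolding z_def of_nat_sum
  proof (rule sum.cong[OF refl])
    fix i assume "i \<in> {..<Suc n}"
    then have "real R ^ (n - i) = real R ^ n / real R ^ i" using R0 by (intro power_diff) auto
    then show "real (d i) * (real R ^ n * ?q ^ i) = real (d i * R ^ (n - i))"
      by (simp add: power_divide)
  qed
  finally have eq: "real R ^ n * (\<Sum>i. real (d i) * ?q ^ i) = \<tau> + real z" .
  have "\<tau> \<ge> 0" unfolding \<tau>_def using q expansion_bounds(1)[OF q d] by simp
  moreover have "\<tau> \<le> 1 / 2"
  proof -
    have "\<tau> \<le> ?q * (real D / (1 - ?q))"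
      unfolding \<tau>_def using q by (intro mult_left_mono expansion_bounds(2)[OF q d]) auto
    also have "\<dots> = real D / (real R - 1)" using R0 by (simp add: field_simps)
    also have "\<dots> \<le> 1 / 2" using R D by (simp add: field_simps)
    finally show ?thesis .
  qed
  ultimately have "h (\<tau> + real z) = real_of_int (int z mod int p)"
    by (intro h) auto
  also have "\<dots> = real (z mod p)" by (simp flip: zmod_int)
  also have "z mod p = d n mod p"
  proof -
    have "p dvd (\<Sum>i<n. d i * R ^ (n - i))"
      using p(2) by (intro dvd_sum dvd_mult) (auto intro: dvd_trans[OF p(2)] dvd_power)
    then have "(\<Sum>i<n. d i * R ^ (n - i)) mod p = 0" by simp
    then show ?thesis unfolding z_def by (simp add: mod_add_left_eq[symmetric])
  qed
  finally show ?thesis unfolding eq .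
qed

section \<open>Choice of parameters and construction of the function\<close>

text \<open>Take \<open>p\<close> about \<open>m powr \<beta> / 4\<close>. Then
  \<open>4 * m * p\<close> is at most \<open>m powr (1 / \<alpha>)\<close>, which is the first
  inequality. It bounds the left side of the second by
  \<open>2 powr s * m powr (k * s / \<alpha>)\<close>, of smaller order than \<open>p\<close>
  because \<open>k * s / \<alpha> < \<beta>\<close>.\<close>

lemma ex_digit_counts:
  fixes \<alpha> s :: real
  assumes \<alpha>: "0 < \<alpha>" "\<alpha> < 1" and s: "0 < s" "real k * s < 1 - \<alpha>"
  obtains m p :: nat where "m \<ge> 2" "p \<ge> 2" "real (4 * (m * p)) powr \<alpha> \<le> real m"
    "(2 * real (4 * (m * p)) ^ k) powr s \<le> real p"
proof -
  define \<beta> where "\<beta> = (1 - \<alpha>) / \<alpha>"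
  define \<gamma> where "\<gamma> = \<beta> - real k * s / \<alpha>"
  have "\<gamma> = (1 - \<alpha> - real k * s) / \<alpha>" by (simp add: \<gamma>_def \<beta>_def diff_divide_distrib)
  then have \<gamma>: "\<gamma> > 0" using s \<alpha> by simp
  \<comment> \<open>This forces \<open>m powr \<gamma> \<ge> 4 * (2 powr s + 1)\<close>: the 4 is
    the divisor in \<open>p\<close>, and the summand 1 pays for rounding down.\<close>
  obtain m where m: "real m \<ge> max 2 ((4 * (2 powr s + 1)) powr (1 / \<gamma>))"
    using real_arch_simple by blast
  then have m2: "m \<ge> 2" by simp
  then have m0: "real m \<ge> 1" by simp
  define p where "p = nat \<lfloor>real m powr \<beta> / 4\<rfloor>"
  have p_le: "real p \<le> real m powr \<beta> / 4" unfolding p_def by (rule of_nat_floor) simp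
  have p_ge: "real m powr \<beta> / 4 - 1 \<le> real p" unfolding p_def by linarith
  have R: "real (4 * (m * p)) \<le> real m powr (1 / \<alpha>)"
  proof -
    have "real (4 * (m * p)) \<le> real m * real m powr \<beta>"
      using p_le m0 by (simp add: field_simps)
    also have "\<dots> = real m powr (1 + \<beta>)" using m0 by (simp add: powr_add)
    also have "1 + \<beta> = 1 / \<alpha>" using \<alpha> by (simp add: \<beta>_def field_simps)
    finally show ?thesis .
  qed
  have "real (4 * (m * p)) powr \<alpha> \<le> (real m powr (1 / \<alpha>)) powr \<alpha>"
    using R \<alpha> by (intro powr_mono2) auto
  also have "\<dots> = real m" using \<alpha> m0 by (simp add: powr_powr)
  finally have 1: "real (4 * (m * p)) powr \<alpha> \<le> real m" .
  have "(2 * real (4 * (m * p)) ^ k) powr s \<le> (2 * (real m powr (1 / \<alpha>)) ^ k) powr s"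
    using R s by (intro powr_mono2 mult_left_mono power_mono) auto
  also have "\<dots> = 2 powr s * real m powr (real k * s / \<alpha>)"
    using m0 by (simp add: powr_mult powr_powr powr_power mult_ac)
  finally have 2: "(2 * real (4 * (m * p)) ^ k) powr s \<le> 2 powr s * real m powr (real k * s / \<alpha>)" .
  have "4 * (2 powr s + 1) = ((4 * (2 powr s + 1)) powr (1 / \<gamma>)) powr \<gamma>"
    using \<gamma> by (simp add: powr_powr add_pos_pos)
  also have "\<dots> \<le> real m powr \<gamma>" using m \<gamma> by (intro powr_mono2) auto
  finally have big: "4 * (2 powr s + 1) \<le> real m powr \<gamma>" .
  have ge1: "1 \<le> real m powr (real k * s / \<alpha>)" using m0 s \<alpha> by (intro ge_one_powr_ge_zero) auto
  have "4 * (2 powr s * real m powr (real k * s / \<alpha>) + 1) \<le>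
      4 * (2 powr s + 1) * real m powr (real k * s / \<alpha>)"
    using ge1 by (simp add: algebra_simps)
  also have "\<dots> \<le> real m powr \<gamma> * real m powr (real k * s / \<alpha>)"
    using big by (intro mult_right_mono) auto
  also have "\<dots> = real m powr \<beta>" by (simp add: \<gamma>_def flip: powr_add)
  finally have 3: "2 powr s * real m powr (real k * s / \<alpha>) \<le> real p" using p_ge by simp
  have "1 < 2 powr s" using s by simp
  then have "1 < 2 powr s * real m powr (real k * s / \<alpha>)"
    using ge1 by (metis less_le_trans mult.right_neutral mult_left_mono powr_ge_zero)
  then have "p \<ge> 2" using 3 by simp
  with that[OF m2 _ 1 order_trans[OF 2 3]] show thesis by blast
qed

lemma ex_C_k_L_dim_ge:
  assumes k: "k \<ge> 1" and \<alpha>: "0 < \<alpha>" "\<alpha> < 1" and s: "0 < s" "real k * s < 1 - \<alpha>"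
    and E: "open E" "E \<noteq> {}"
  shows "\<exists>f\<in>C_k k E. ereal s \<le> L_dim E \<alpha> f"
proof -
  obtain m p :: nat where m: "m \<ge> 2" and p: "p \<ge> 2"
    and Rm: "real (4 * (m * p)) powr \<alpha> \<le> real m"
    and Rp: "(2 * real (4 * (m * p)) ^ k) powr s \<le> real p"
    using ex_digit_counts[OF \<alpha> s] by blast
  define D where "D = m * p"
  define R where "R = 4 * D"
  \<comment> \<open>The factor 2 makes \<open>\<rho> * R ^ k < 1\<close> strict, as the lacunary
    series requires; it is the 2 in the second inequality of \<open>ex_digit_counts\<close>.\<close>
  define \<rho> where "\<rho> = 1 / (2 * real R ^ k)"
  have D: "D > 0" using m p by (simp add: D_def)
  have R4: "real R \<ge> 4" using D by (simp add: R_def)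
  have Rk: "real R \<le> real R ^ k" using R4 k by (intro self_le_power) auto
  have \<rho>: "0 < \<rho>" "\<rho> * real R ^ k < 1" using R4 by (auto simp: \<rho>_def)
  have p\<rho>: "4 * real p * \<rho> \<le> 1"
  proof -
    have "1 * p \<le> m * p" using m by (intro mult_le_mono1) simp
    then have "2 * p \<le> R" by (simp add: R_def D_def)
    then have "2 * real p \<le> real R" by linarith
    then have "2 * real p \<le> real R ^ k" using Rk by (rule order_trans)
    then show ?thesis using R4 by (simp add: \<rho>_def field_simps)
  qed
  obtain h where h: "h \<in> C_k k UNIV" "\<And>t. h (t + real p) = h t"
    "\<And>z t. \<lbrakk>real_of_int z \<le> t; t \<le> real_of_int z + 1 / 2\<rbrakk> \<Longrightarrow> h t = real_of_int (z mod int p)"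
    using ex_C_k_residue[OF p, of k] by auto
  define F where "F x = (\<Sum>n. \<rho> ^ n * h (real R ^ n * x))" for x
  have F: "F \<in> C_k k UNIV" unfolding F_def
    by (rule C_k_lacunary_series)
      (use R4 h \<rho> p C_k_periodic_derivs_bounded[OF h(1) _ h(2)] in auto)
  obtain e r where e: "r > 0" "ball e r \<subseteq> E"
    using E by (meson all_not_in_conv openE)
  \<comment> \<open>All sums \<open>x u y\<close> lie in \<open>[0, 2 * D]\<close>; division by
    \<open>c\<close> brings them into \<open>[0, r / 2]\<close>, so \<open>e + x u y / c\<close>
    stays in the ball.\<close>
  define c where "c = 4 * real D / r"
  have c: "c > 0" using e D by (simp add: c_def)
  define f where "f x = F (c * (x - e))" for x
  have "f \<in> C_k k UNIV" unfolding f_def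
    by (intro C_k_compose[OF F] C_k_mult C_k_diff C_k_const C_k_ident)
  then have f: "f \<in> C_k k E" by (auto simp: C_k_def intro: continuous_on_subset)
  \<comment> \<open>Two independent digit streams in one argument: modulo \<open>p\<close> only the
    digit of \<open>u\<close> is visible to \<open>h\<close>, so \<open>u\<close> determines the
    value of \<open>F\<close> while \<open>y\<close> moves within the fibre.\<close>
  define d where "d u y i = digit p u i + p * digit m y i" for u y i
  define x where "x u y = (\<Sum>i. real (d u y i) * (1 / real R) ^ i)" for u y
  define Y where "Y u = (\<Sum>i. real (digit p u i) * \<rho> ^ i)" for u
  have d: "d u y i < D" for u y i
  proof -
    have "digit p u i < p" using p by (intro digit_less) simp
    moreover have "digit m y i < m" using m by (intro digit_less) simp
    ultimately have "d u y i < p * Suc (digit m y i)" by (simp add: d_def)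
    also have "\<dots> \<le> p * m" using \<open>digit m y i < m\<close> by (intro mult_le_mono2 Suc_leI)
    finally show ?thesis by (simp add: D_def mult.commute)
  qed
  have Fx: "F (x u y) = Y u" for u y
  proof -
    have "h (real R ^ n * x u y) = real (digit p u n)" for n
    proof -
      have "h (real R ^ n * x u y) = real (d u y n mod p)"
        unfolding x_def
        by (rule residue_function_at_expansion[OF R_def D _ _ d h(3)]) (use p in \<open>auto simp: R_def D_def\<close>)
      also have "d u y n mod p = digit p u n" using digit_less[of p u n] p by (simp add: d_def)
      finally show ?thesis .
    qed
    then show ?thesis by (simp add: F_def Y_def mult.commute)
  qed
  have q: "0 < 1 / real R" "1 / real R < 1" using R4 by auto
  have "Y u \<in> I_set E \<alpha> f" for u
  proof -
    let ?X = "\<lambda>y. e + x u y / c"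
    have "ereal \<alpha> \<le> hausdorff_dim (level_set E f (Y u))"
    \<comment> \<open>Here \<open>u\<close> is fixed and the base \<open>m\<close> digits of
      \<open>y\<close> vary with ratio \<open>1 / R\<close>; the dimension comes from
      \<open>R powr \<alpha> \<le> m\<close>.\<close>
    proof (rule hausdorff_dim_ge_if_expansion[OF m q(1) _ \<alpha>(1) _ d])
      show "4 * real D * (1 / real R) \<le> 1" using D by (simp add: R_def)
      show "1 / real m \<le> (1 / real R) powr \<alpha>"
        using Rm[folded D_def, folded R_def] m R4 by (simp add: powr_divide field_simps)
      show "d u y i = d u z i \<longleftrightarrow> digit m y i = digit m z i" for y z i
        using p by (simp add: d_def)
      show "1 / c > 0" using c by simp
      show "dist (?X y) (?X z) = 1 / c *
          \<bar>(\<Sum>i. real (d u y i) * (1 / real R) ^ i) - (\<Sum>i. real (d u z i) * (1 / real R) ^ i)\<bar>" for y z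
        using c by (simp add: x_def[symmetric] dist_real_def abs_divide flip: diff_divide_distrib)
      show "?X ` {0..<1} \<subseteq> level_set E f (Y u)"
      proof
        fix t assume "t \<in> ?X ` {0..<1}"
        then obtain y where t: "t = e + x u y / c" by blast
        have "x u y \<le> real D / (1 - 1 / real R)" "0 \<le> x u y"
          unfolding x_def by (rule expansion_bounds[OF q d])+
        moreover have "real D / (1 - 1 / real R) \<le> 2 * real D"
        proof -
          have "1 \<le> 2 * (1 - 1 / real R)" using R4 by (simp add: field_simps)
          then have "real D * 1 \<le> real D * (2 * (1 - 1 / real R))" by (intro mult_left_mono) auto
          then show ?thesis using q by (simp add: pos_divide_le_eq mult_ac)
        qed
        ultimately have "\<bar>x u y / c\<bar> \<le> 2 * real D / c"
          using c by (simp add: divide_right_mono)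
        also have "\<dots> < r" using D e by (simp add: c_def)
        finally have "t \<in> E" using e(2) by (auto simp: t dist_real_def)
        moreover have "f t = Y u" using c Fx by (simp add: f_def t)
        ultimately show "t \<in> level_set E f (Y u)" by (simp add: level_set_def)
      qed
    qed
    then show ?thesis by (simp add: I_set_def)
  qed
  then have "Y ` {0..<1} \<subseteq> I_set E \<alpha> f" by blast
  then have "ereal s \<le> L_dim E \<alpha> f"
    unfolding L_dim_def
  \<comment> \<open>Now the base \<open>p\<close> digits of \<open>u\<close> vary with ratio
    \<open>\<rho>\<close>, and \<open>1 / p \<le> \<rho> powr s\<close> is the second inequality of
    \<open>ex_digit_counts\<close>.\<close>
  proof (rule hausdorff_dim_ge_if_expansion[OF p \<rho>(1) p\<rho> s(1), rotated -1])
    show "1 / real p \<le> \<rho> powr s"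
      using Rp[folded D_def, folded R_def] p R4 by (simp add: \<rho>_def powr_divide field_simps)
    show "digit p y i < p" for y i using p by (intro digit_less) simp
    show "(1::real) > 0" by simp
  qed (auto simp: Y_def dist_real_def)
  then show ?thesis using f by blast
qed

theorem theorem1:
  fixes k :: nat and \<alpha> :: real and E :: "real set"
  assumes "k \<ge> 1"
    and "0 < \<alpha>" and "\<alpha> < 1"
    and "open E" and "is_interval E" and "E \<noteq> {}"
  shows "(SUP f\<in>C_k k E. L_dim E \<alpha> f) = ereal ((1 - \<alpha>) / real k)"
proof (rule antisym)
  show "(SUP f\<in>C_k k E. L_dim E \<alpha> f) \<le> ereal ((1 - \<alpha>) / real k)"
    using assms by (intro SUP_least L_dim_le)
  show "ereal ((1 - \<alpha>) / real k) \<le> (SUP f\<in>C_k k E. L_dim E \<alpha> f)"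
  \<comment> \<open>The construction yields only real \<open>s > 0\<close> strictly below the bound,
    so the bound is approached from below; \<open>max t 0\<close> keeps \<open>s\<close> positive
    even if \<open>t\<close> is negative or minus infinity.\<close>
  proof (rule dense_le)
    fix t assume t: "t < ereal ((1 - \<alpha>) / real k)"
    have "max t 0 < ereal ((1 - \<alpha>) / real k)" using t assms by simp
    then obtain s where s: "max t 0 < ereal s" "ereal s < ereal ((1 - \<alpha>) / real k)"
      using ereal_dense2 by blast
    then have "0 < s" "real k * s < 1 - \<alpha>" using assms(1) by (auto simp: field_simps)
    then obtain f where f: "f \<in> C_k k E" "ereal s \<le> L_dim E \<alpha> f"
      using ex_C_k_L_dim_ge assms by blast
    have "t \<le> ereal s" using s(1) by (simp add: less_imp_le)
    also note f(2)
    also have "L_dim E \<alpha> f \<le> (SUP f\<in>C_k k E. L_dim E \<alpha> f)" using f(1) by (rule SUP_upper)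
    finally show "t \<le> (SUP f\<in>C_k k E. L_dim E \<alpha> f)" .
  qed
qed

end
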